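(* For every completely regular frame $L$, the following hold for the $\sigma$-frame $\mathrm{Coz}_c[L]=\{\mathrm{coz}(\alpha)\mid \alpha\in\mathcal C_c(L)\}$ (with the order inherited from $L$): (1) $\mathrm{Coz}_c[L]$ is paracompact. (2) Each cover of $\mathrm{Coz}_c[L]$ is shrinkable.
   Context: Let $L$ be a frame with top $\top$ and bottom $\bot$. The frame of reals $\mathcal L(\mathbb R)$ is generated by pairs $(p,q)$, $p,q\in\mathbb Q$, subject to: (R1) $(p,q)\wedge(r,s)=(p\vee r,q\wedge s)$; (R2) $(p,q)\vee(r,s)=(p,s)$ whenever $p\le r<q\le s$; (R3) $(p,q)=\bigvee\{(r,s)\mid p<r<s<q\}$; (R4) $\top=\bigvee\{(p,q)\mid p,q\in\mathbb Q\}$. $\mathcal R(L)$ is the set of frame homomorphisms $\mathcal L(\mathbb R)\to L$; it is an $f$-ring with operations, for $\diamond\in\{+,\cdot,\wedge,\vee\}$, $(\alpha\diamond\beta)(p,q)=\bigvee\{\alpha(r,s)\wedge\beta(u,v)\mid \langle r,s\rangle\diamond\langle u,v\rangle\subseteq\langle p,q\rangle\}$, where $\langle p,q\rangle=\{t\in\mathbb R\mid p<t<q\}$. For $r\in\mathbb R$, the constant $\mathbf r\in\mathcal R(L)$ satisfies $\mathbf r(p,q)=\top$ if $p<r<q$ and $\bot$ otherwise; $\alpha-r$ means $\alpha-\mathbf r$. Put $(p,-)=\bigvee_{r,s>p}(r,s)$ and $(-,q)=\bigvee_{r,s<q}(r,s)$ (with $r,s\in\mathbb Q$). The cozero element of $\alpha$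 is $\mathrm{coz}(\alpha)=\alpha(-,0)\vee\alpha(0,-)$. Put $R_\alpha=\{r\in\mathbb R\mid \mathrm{coz}(\alpha-r)\ne\top\}$ and $\mathcal C_c(L)=\{\alpha\in\mathcal R(L)\mid R_\alpha\text{ is countable}\}$ (countable includes finite). $L$ is completely regular iff every element of $L$ is the join of elements of the form $\mathrm{coz}(\alpha)$, $\alpha\in\mathcal R(L)$. A $\sigma$-frame is a distributive lattice $M$ in which every countable subset has a join and $a\wedge\bigvee S=\bigvee_{s\in S}(a\wedge s)$ for all $a\in M$ and countable $S\subseteq M$. In a $\sigma$-frame $M$ with top $\top$ and bottom $\bot$: $a\prec b$ means there is $x\in M$ with $a\wedge x=\bot$ and $x\vee b=\top$. A cover of $M$ is a sequence $(a_n)_{n=1}^\infty$ in $M$ with $\bigvee_{n=1}^\infty a_n=\top$. A cover $(b_n)$ is locally finite if there is a cover $(c_n)$ of $M$ and, for each $m$, a finite subset $p(m)\subseteq\mathbb N$ such that $c_m\wedge b_n=\bot$ whenever $n\notin p(m)$. $M$ is paracompact if for each cover $(a_n)$ of $M$ there is a locally finite cover $(b_m)$ of $M$ such that for each $m$ there is some $n$ with $b_m\le a_n$. A cover $(a_n)$ is shrinkable if there is a cover $(d_n)$ of $M$ with $d_n\prec a_n$ for every $n$. *)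

theory Defs
  imports Complex_Main "HOL-Library.Countable_Set" "HOL-Algebra.Lattice"
begin

hide_const (open) Order.top

text \<open>The class \<^class>\<open>complete_distrib_lattice\<close> demands complete distributivity, which
  is too strong for a frame.\<close>

class frame = complete_lattice +
  assumes inf_Sup_frame: "inf a (Sup S) = (SUP s\<in>S. inf a s)"

definition frame_hom :: "('a::frame \<Rightarrow> 'b::frame) \<Rightarrow> bool" where
  "frame_hom f \<longleftrightarrow> f top = top \<and> (\<forall>x y. f (inf x y) = inf (f x) (f y)) \<and>
     (\<forall>S. f (Sup S) = (SUP x\<in>S. f x))"

text \<open>A map from pairs of rationals into a frame that turns (R1)--(R4) into identities.\<close>

definition real_relations :: "(rat \<Rightarrow> rat \<Rightarrow> 'a::frame) \<Rightarrow> bool" where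
  "real_relations \<phi> \<longleftrightarrow>
     (\<forall>p q r s. inf (\<phi> p q) (\<phi> r s) = \<phi> (max p r) (min q s)) \<and>
     (\<forall>p q r s. p \<le> r \<and> r < q \<and> q \<le> s \<longrightarrow> sup (\<phi> p q) (\<phi> r s) = \<phi> p s) \<and>
     (\<forall>p q. \<phi> p q = Sup {\<phi> r s | r s. p < r \<and> r < s \<and> s < q}) \<and>
     top = Sup {\<phi> p q | p q. True}"

lemma real_relationsD:
  assumes "real_relations \<phi>"
  shows "inf (\<phi> p q) (\<phi> r s) = \<phi> (max p r) (min q s)"
    and "p \<le> r \<Longrightarrow> r < q \<Longrightarrow> q \<le> s \<Longrightarrow> sup (\<phi> p q) (\<phi> r s) = \<phi> p s"
    and "\<phi> p q = Sup {\<phi> r s | r s. p < r \<and> r < s \<and> s < q}"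
    and "Sup {\<phi> p q | p q. True} = top"
proof -
  note R1 = assms[unfolded real_relations_def, THEN conjunct1]
    and R = assms[unfolded real_relations_def, THEN conjunct2]
  note R2 = R[THEN conjunct1] and R3 = R[THEN conjunct2, THEN conjunct1]
    and R4 = R[THEN conjunct2, THEN conjunct2]
  show "inf (\<phi> p q) (\<phi> r s) = \<phi> (max p r) (min q s)" by (rule R1[rule_format])
  show "p \<le> r \<Longrightarrow> r < q \<Longrightarrow> q \<le> s \<Longrightarrow> sup (\<phi> p q) (\<phi> r s) = \<phi> p s"
    by (rule R2[rule_format]) (intro conjI)
  show "\<phi> p q = Sup {\<phi> r s | r s. p < r \<and> r < s \<and> s < q}" by (rule R3[rule_format])
  show "Sup {\<phi> p q | p q. True} = top" by (rule R4[symmetric])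
qed

text \<open>The frame presented by generators \<open>(p, q)\<close> and relations (R1)--(R4) is realised as the frame
  of ideals for the coverage given by (R2) and (R3) on the meet-semilattice of rational pairs, whose
  meet is dictated by (R1). An ideal \<open>U\<close> stands for the join of the generators in \<open>U\<close>. That this is
  the frame presented by these generators and relations is shown below in \<open>real_relations_gen\<close>,
  \<open>frame_hom_lift_gen\<close>, \<open>lift_gen_gen\<close> and \<open>frame_hom_eq_lift_gen\<close>.\<close>

definition real_ideal :: "(rat \<times> rat) set \<Rightarrow> bool" where
  "real_ideal U \<longleftrightarrow>
     (\<forall>p q r s. (p, q) \<in> U \<and> p \<le> r \<and> s \<le> q \<longrightarrow> (r, s) \<in> U) \<and>
     (\<forall>p q r s. (p, q) \<in> U \<and> (r, s) \<in> U \<and> p \<le> r \<and> r < q \<and> q \<le> s \<longrightarrow> (p, s) \<in> U) \<and>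
     (\<forall>p q. (\<forall>r s. p < r \<and> r < s \<and> s < q \<longrightarrow> (r, s) \<in> U) \<longrightarrow> (p, q) \<in> U)"

lemma real_idealD:
  assumes "real_ideal U"
  shows "(p, q) \<in> U \<Longrightarrow> p \<le> r \<Longrightarrow> s \<le> q \<Longrightarrow> (r, s) \<in> U"
    and "(p, q) \<in> U \<Longrightarrow> (r, s) \<in> U \<Longrightarrow> p \<le> r \<Longrightarrow> r < q \<Longrightarrow> q \<le> s \<Longrightarrow> (p, s) \<in> U"
    and "(\<And>r s. p < r \<Longrightarrow> r < s \<Longrightarrow> s < q \<Longrightarrow> (r, s) \<in> U) \<Longrightarrow> (p, q) \<in> U"
  using assms unfolding real_ideal_def by blast+

lemma real_idealI:
  assumes "\<And>p q r s. (p, q) \<in> U \<Longrightarrow> p \<le> r \<Longrightarrow> s \<le> q \<Longrightarrow> (r, s) \<in> U"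
    and "\<And>p q r s. (p, q) \<in> U \<Longrightarrow> (r, s) \<in> U \<Longrightarrow> p \<le> r \<Longrightarrow> r < q \<Longrightarrow> q \<le> s \<Longrightarrow> (p, s) \<in> U"
    and "\<And>p q. (\<And>r s. p < r \<Longrightarrow> r < s \<Longrightarrow> s < q \<Longrightarrow> (r, s) \<in> U) \<Longrightarrow> (p, q) \<in> U"
  shows "real_ideal U"
  using assms unfolding real_ideal_def by blast

lemma real_ideal_UNIV: "real_ideal UNIV"
  by (simp add: real_ideal_def)

lemma real_ideal_Inter: "(\<And>U. U \<in> A \<Longrightarrow> real_ideal U) \<Longrightarrow> real_ideal (\<Inter>A)"
  unfolding real_ideal_def Inter_iff by meson

lemma real_ideal_Int: "real_ideal U \<Longrightarrow> real_ideal V \<Longrightarrow> real_ideal (U \<inter> V)"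
  using real_ideal_Inter[of "{U, V}"] by auto

definition real_ideal_hull :: "(rat \<times> rat) set \<Rightarrow> (rat \<times> rat) set" where
  "real_ideal_hull A = \<Inter>{U. real_ideal U \<and> A \<subseteq> U}"

lemma real_ideal_hull: "real_ideal (real_ideal_hull A)"
  unfolding real_ideal_hull_def by (rule real_ideal_Inter) simp

lemma real_ideal_hull_subset: "A \<subseteq> real_ideal_hull A"
  unfolding real_ideal_hull_def by blast

lemma real_ideal_hull_least: "real_ideal U \<Longrightarrow> A \<subseteq> U \<Longrightarrow> real_ideal_hull A \<subseteq> U"
  unfolding real_ideal_hull_def by blast

typedef frame_of_reals = "{U :: (rat \<times> rat) set. real_ideal U}"
  morphisms ideal_of Abs_frame_of_reals
  using real_ideal_UNIV by blast

setup_lifting type_definition_frame_of_reals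

lemma real_ideal_ideal_of: "real_ideal (ideal_of x)"
  using ideal_of by simp

instantiation frame_of_reals :: complete_lattice
begin

lift_definition less_eq_frame_of_reals :: "frame_of_reals \<Rightarrow> frame_of_reals \<Rightarrow> bool" is "(\<subseteq>)" .
lift_definition less_frame_of_reals :: "frame_of_reals \<Rightarrow> frame_of_reals \<Rightarrow> bool" is "(\<subset>)" .
lift_definition inf_frame_of_reals :: "frame_of_reals \<Rightarrow> frame_of_reals \<Rightarrow> frame_of_reals" is "(\<inter>)"
  by (rule real_ideal_Int)
lift_definition sup_frame_of_reals :: "frame_of_reals \<Rightarrow> frame_of_reals \<Rightarrow> frame_of_reals"
  is "\<lambda>U V. real_ideal_hull (U \<union> V)" by (rule real_ideal_hull)
lift_definition bot_frame_of_reals :: frame_of_reals is "real_ideal_hull {}"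
  by (rule real_ideal_hull)
lift_definition top_frame_of_reals :: frame_of_reals is UNIV
  by (rule real_ideal_UNIV)
lift_definition Inf_frame_of_reals :: "frame_of_reals set \<Rightarrow> frame_of_reals" is Inter
  by (rule real_ideal_Inter)
lift_definition Sup_frame_of_reals :: "frame_of_reals set \<Rightarrow> frame_of_reals"
  is "\<lambda>A. real_ideal_hull (\<Union>A)" by (rule real_ideal_hull)

instance
proof
  fix x y z :: frame_of_reals and A :: "frame_of_reals set"
  show "(x < y) = (x \<le> y \<and> \<not> y \<le> x)" by transfer blast
  show "x \<le> x" by transfer blast
  show "x \<le> y \<Longrightarrow> y \<le> z \<Longrightarrow> x \<le> z" by transfer blast
  show "x \<le> y \<Longrightarrow> y \<le> x \<Longrightarrow> x = y" by transfer blast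
  show "inf x y \<le> x" "inf x y \<le> y" by (transfer, blast)+
  show "x \<le> y \<Longrightarrow> x \<le> z \<Longrightarrow> x \<le> inf y z" by transfer blast
  show "x \<le> sup x y" "y \<le> sup x y" by (transfer, use real_ideal_hull_subset in blast)+
  show "y \<le> x \<Longrightarrow> z \<le> x \<Longrightarrow> sup y z \<le> x" by transfer (rule real_ideal_hull_least; simp)
  show "x \<in> A \<Longrightarrow> Inf A \<le> x" by transfer blast
  show "(\<And>x. x \<in> A \<Longrightarrow> z \<le> x) \<Longrightarrow> z \<le> Inf A" by transfer blast
  show "x \<in> A \<Longrightarrow> x \<le> Sup A" by transfer (use real_ideal_hull_subset in blast)
  show "(\<And>x. x \<in> A \<Longrightarrow> x \<le> z) \<Longrightarrow> Sup A \<le> z" by transfer (rule real_ideal_hull_least; blast)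
  show "Inf {} = (top :: frame_of_reals)" by transfer simp
  show "Sup {} = (bot :: frame_of_reals)" by transfer simp
qed

end

instance frame_of_reals :: frame
proof
  fix x :: frame_of_reals and S :: "frame_of_reals set"
  have "ideal_of (inf x (Sup S)) \<subseteq> ideal_of (SUP s\<in>S. inf x s)"
  proof -
    define U where "U = ideal_of x"
    define W where "W = ideal_of (SUP s\<in>S. inf x s)"
    define V where "V = {(p, q). \<forall>(a, b) \<in> U. (max p a, min q b) \<in> W}"
    have U: "real_ideal U" and W: "real_ideal W"
      by (simp_all add: U_def W_def real_ideal_ideal_of)
    have degen: "(a, b) \<in> W" if "b \<le> a" for a b
      by (rule real_idealD(3)[OF W]) (use that in auto)
    have "real_ideal V"
    proof (rule real_idealI)
      fix p q r s assume pq: "(p, q) \<in> V" "p \<le> r" "s \<le> q"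
      have "(max r a, min s b) \<in> W" if "(a, b) \<in> U" for a b
      proof (rule real_idealD(1)[OF W])
        show "(max p a, min q b) \<in> W" using pq that by (auto simp: V_def)
      qed (use pq in auto)
      then show "(r, s) \<in> V" by (auto simp: V_def)
    next
      fix p q r s assume A: "(p, q) \<in> V" "(r, s) \<in> V" "p \<le> r" "r < q" "q \<le> s"
      have "(max p a, min s b) \<in> W" if "(a, b) \<in> U" for a b
      proof -
        have 1: "(max p a, min q b) \<in> W" and 2: "(max r a, min s b) \<in> W"
          using A that by (auto simp: V_def)
        consider "max r a < min q b" | "b \<le> r" | "q \<le> a" | "b \<le> a"
          using \<open>r < q\<close> by (metis max_less_iff_conj min_less_iff_conj not_le)
        then show ?thesis
        proof cases
          case 1
          show ?thesis
            by (rule real_idealD(2)[OF W \<open>(max p a, min q b) \<in> W\<close> 2]) (use 1 A in auto)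
        next
          case 2
          then have "min s b = min q b" using A by (simp add: min_def)
          with 1 show ?thesis by simp
        next
          case 3
          then have "max p a = max r a" using A by (simp add: max_def)
          with 2 show ?thesis by simp
        next
          case 4
          then show ?thesis by (intro degen) (simp add: min_def max_def)
        qed
      qed
      then show "(p, s) \<in> V" by (auto simp: V_def)
    next
      fix p q assume A: "\<And>r s. p < r \<Longrightarrow> r < s \<Longrightarrow> s < q \<Longrightarrow> (r, s) \<in> V"
      have "(max p a, min q b) \<in> W" if "(a, b) \<in> U" for a b
      proof (rule real_idealD(3)[OF W])
        fix r s assume "max p a < r" "r < s" "s < min q b"
        then have "(r, s) \<in> V" "max r a = r" "min s b = s" using A by auto
        then show "(r, s) \<in> W" using that by (auto simp: V_def)
      qed
      then show "(p, q) \<in> V" by (auto simp: V_def)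
    qed
    moreover have "\<Union>(ideal_of ` S) \<subseteq> V"
    proof
      fix z assume "z \<in> \<Union>(ideal_of ` S)"
      then obtain s p q where z: "s \<in> S" "z = (p, q)" "(p, q) \<in> ideal_of s"
        by (metis UN_E surj_pair)
      have "inf x s \<le> (SUP s\<in>S. inf x s)" using z(1) by (rule SUP_upper)
      then have sub: "U \<inter> ideal_of s \<subseteq> W"
        unfolding U_def W_def less_eq_frame_of_reals.rep_eq inf_frame_of_reals.rep_eq .
      have "(max p a, min q b) \<in> W" if "(a, b) \<in> U" for a b
      proof -
        have "(max p a, min q b) \<in> U" by (rule real_idealD(1)[OF U that]) auto
        moreover have "(max p a, min q b) \<in> ideal_of s"
          by (rule real_idealD(1)[OF real_ideal_ideal_of z(3)]) auto
        ultimately show ?thesis using sub by blast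
      qed
      then show "z \<in> V" using z by (auto simp: V_def)
    qed
    ultimately have "real_ideal_hull (\<Union>(ideal_of ` S)) \<subseteq> V" by (rule real_ideal_hull_least)
    moreover have "U \<inter> V \<subseteq> W"
    proof
      fix z assume "z \<in> U \<inter> V"
      then obtain p q where "z = (p, q)" "(p, q) \<in> U" "(p, q) \<in> V" by (metis IntE surj_pair)
      then show "z \<in> W" by (auto simp: V_def)
    qed
    ultimately show ?thesis
      unfolding inf_frame_of_reals.rep_eq Sup_frame_of_reals.rep_eq[of S] U_def W_def by blast
  qed
  then have "inf x (Sup S) \<le> (SUP s\<in>S. inf x s)" by (simp add: less_eq_frame_of_reals.rep_eq)
  moreover have "(SUP s\<in>S. inf x s) \<le> inf x (Sup S)"
    by (intro SUP_least inf_mono order_refl Sup_upper)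
  ultimately show "inf x (Sup S) = (SUP s\<in>S. inf x s)" by (rule antisym)
qed

lemma real_ideal_gen: "real_ideal {(r, s). s \<le> r \<or> (p \<le> r \<and> s \<le> q)}"
proof (rule real_idealI)
  fix a b :: rat
  assume A: "\<And>r s. a < r \<Longrightarrow> r < s \<Longrightarrow> s < b \<Longrightarrow> (r, s) \<in> {(r, s). s \<le> r \<or> (p \<le> r \<and> s \<le> q)}"
  show "(a, b) \<in> {(r, s). s \<le> r \<or> (p \<le> r \<and> s \<le> q)}"
  proof (cases "a < b")
    case True
    have "p \<le> a"
    proof (rule dense_ge_bounded[OF True])
      fix r assume r: "a < r" "r < b"
      then obtain s where "r < s" "s < b" using dense by blast
      then show "p \<le> r" using A[of r s] r by auto
    qed
    moreover have "b \<le> q"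
    proof (rule dense_le_bounded[OF True])
      fix s assume s: "a < s" "s < b"
      then obtain r where "a < r" "r < s" using dense by blast
      then show "s \<le> q" using A[of r s] s by auto
    qed
    ultimately show ?thesis by simp
  qed simp
next
  fix a b r s :: rat
  assume "(a, b) \<in> {(r, s). s \<le> r \<or> (p \<le> r \<and> s \<le> q)}" "a \<le> r" "s \<le> b"
  then have "b \<le> a \<or> (p \<le> a \<and> b \<le> q)" "a \<le> r" "s \<le> b" by simp_all
  then have "s \<le> r \<or> (p \<le> r \<and> s \<le> q)" by linarith
  then show "(r, s) \<in> {(r, s). s \<le> r \<or> (p \<le> r \<and> s \<le> q)}" by simp
next
  fix a b r s :: rat
  assume "(a, b) \<in> {(r, s). s \<le> r \<or> (p \<le> r \<and> s \<le> q)}"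
    "(r, s) \<in> {(r, s). s \<le> r \<or> (p \<le> r \<and> s \<le> q)}" "a \<le> r" "r < b" "b \<le> s"
  then have "b \<le> a \<or> (p \<le> a \<and> b \<le> q)" "s \<le> r \<or> (p \<le> r \<and> s \<le> q)" "a \<le> r" "r < b" "b \<le> s"
    by simp_all
  then have "s \<le> a \<or> (p \<le> a \<and> s \<le> q)" by linarith
  then show "(a, s) \<in> {(r, s). s \<le> r \<or> (p \<le> r \<and> s \<le> q)}" by simp
qed

text \<open>The generator \<open>(p, q)\<close>; by (R3), pairs \<open>(r, s)\<close> with \<open>s \<le> r\<close> are the bottom element, so
  they belong to every ideal.\<close>

definition gen :: "rat \<Rightarrow> rat \<Rightarrow> frame_of_reals" where
  "gen p q = Abs_frame_of_reals {(r, s). s \<le> r \<or> (p \<le> r \<and> s \<le> q)}"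

lemma ideal_of_gen: "ideal_of (gen p q) = {(r, s). s \<le> r \<or> (p \<le> r \<and> s \<le> q)}"
  unfolding gen_def by (rule Abs_frame_of_reals_inverse) (simp add: real_ideal_gen)

lemma gen_le_iff: "gen p q \<le> x \<longleftrightarrow> (p, q) \<in> ideal_of x"
proof
  note x = real_ideal_ideal_of[of x]
  assume A: "(p, q) \<in> ideal_of x"
  have "(r, s) \<in> ideal_of x" if "s \<le> r" for r s
    by (rule real_idealD(3)[OF x]) (use that in auto)
  moreover have "(r, s) \<in> ideal_of x" if "p \<le> r" "s \<le> q" for r s
    by (rule real_idealD(1)[OF x A that])
  ultimately show "gen p q \<le> x"
    unfolding less_eq_frame_of_reals.rep_eq ideal_of_gen by auto
next
  assume "gen p q \<le> x"
  then have "ideal_of (gen p q) \<subseteq> ideal_of x" by (simp only: less_eq_frame_of_reals.rep_eq)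
  moreover have "(p, q) \<in> ideal_of (gen p q)" by (simp add: ideal_of_gen)
  ultimately show "(p, q) \<in> ideal_of x" by blast
qed

lemma gen_le_gen_iff: "gen r s \<le> gen p q \<longleftrightarrow> s \<le> r \<or> (p \<le> r \<and> s \<le> q)"
  by (simp add: gen_le_iff ideal_of_gen)

lemma frame_of_reals_generated: "x = Sup {gen p q | p q. gen p q \<le> x}"
proof (rule antisym)
  have "(p, q) \<in> ideal_of (Sup {gen p q | p q. gen p q \<le> x})" if "(p, q) \<in> ideal_of x" for p q
    unfolding gen_le_iff[symmetric] by (rule Sup_upper) (use that in \<open>auto simp: gen_le_iff\<close>)
  then show "x \<le> Sup {gen p q | p q. gen p q \<le> x}"
    by (auto simp: less_eq_frame_of_reals.rep_eq)
qed (auto intro: Sup_least)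

lemma real_relations_gen: "real_relations gen"
  unfolding real_relations_def
proof (intro conjI allI impI)
  fix p q r s
  show "inf (gen p q) (gen r s) = gen (max p r) (min q s)"
    unfolding ideal_of_inject[symmetric] inf_frame_of_reals.rep_eq ideal_of_gen by auto
next
  fix p q r s :: rat assume A: "p \<le> r \<and> r < q \<and> q \<le> s"
  show "sup (gen p q) (gen r s) = gen p s"
  proof (rule antisym)
    have "gen p q \<le> sup (gen p q) (gen r s)" "gen r s \<le> sup (gen p q) (gen r s)" by simp_all
    then show "gen p s \<le> sup (gen p q) (gen r s)"
      unfolding gen_le_iff using A real_idealD(2)[OF real_ideal_ideal_of] by blast
  qed (use A in \<open>auto simp: gen_le_gen_iff\<close>)
next
  fix p q
  show "gen p q = Sup {gen r s | r s. p < r \<and> r < s \<and> s < q}"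
  proof (rule antisym)
    have "gen r s \<le> Sup {gen r s | r s. p < r \<and> r < s \<and> s < q}" if "p < r" "r < s" "s < q" for r s
      by (rule Sup_upper) (use that in blast)
    then show "gen p q \<le> Sup {gen r s | r s. p < r \<and> r < s \<and> s < q}"
      unfolding gen_le_iff using real_idealD(3)[OF real_ideal_ideal_of] by blast
  qed (auto intro!: Sup_least simp: gen_le_gen_iff)
next
  show "top = Sup {gen p q | p q. True}"
    using frame_of_reals_generated[of top] by simp
qed

text \<open>The extension of a map on generators to the frame of reals.\<close>

definition lift_gen :: "(rat \<Rightarrow> rat \<Rightarrow> 'a::frame) \<Rightarrow> frame_of_reals \<Rightarrow> 'a" where
  "lift_gen \<phi> x = Sup {\<phi> p q | p q. gen p q \<le> x}"

lemma real_relations_mono: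
  assumes "real_relations \<phi>" "p \<le> r" "s \<le> q"
  shows "\<phi> r s \<le> \<phi> p q"
proof -
  have "inf (\<phi> p q) (\<phi> r s) = \<phi> (max p r) (min q s)"
    by (rule real_relationsD(1)[OF assms(1)])
  also have "\<dots> = \<phi> r s" using assms by (simp add: max_def min_def)
  finally show ?thesis by (metis inf.cobounded1)
qed

lemma real_relations_degenerate:
  assumes "real_relations \<phi>" "q \<le> p"
  shows "\<phi> p q = bot"
proof -
  have "\<phi> p q = Sup {\<phi> r s | r s. p < r \<and> r < s \<and> s < q}"
    by (rule real_relationsD(3)[OF assms(1)])
  also have "{\<phi> r s | r s. p < r \<and> r < s \<and> s < q} = {}" using assms(2) by auto
  finally show ?thesis by simp
qed

lemma lift_gen_gen:
  assumes "real_relations \<phi>"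
  shows "lift_gen \<phi> (gen p q) = \<phi> p q"
proof (rule antisym)
  show "lift_gen \<phi> (gen p q) \<le> \<phi> p q"
    unfolding lift_gen_def
    by (rule Sup_least)
      (auto simp: gen_le_gen_iff real_relations_mono[OF assms] real_relations_degenerate[OF assms])
qed (auto simp: lift_gen_def intro!: Sup_upper)

lemma frame_hom_lift_gen:
  assumes "real_relations \<phi>"
  shows "frame_hom (lift_gen \<phi>)"
  unfolding frame_hom_def
proof (intro conjI allI)
  show "lift_gen \<phi> top = top"
    using real_relationsD(4)[OF assms] by (simp add: lift_gen_def)
next
  fix x y
  show "lift_gen \<phi> (inf x y) = inf (lift_gen \<phi> x) (lift_gen \<phi> y)"
  proof (rule antisym)
    show "lift_gen \<phi> (inf x y) \<le> inf (lift_gen \<phi> x) (lift_gen \<phi> y)"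
      unfolding lift_gen_def by (intro le_infI Sup_subset_mono) auto
  next
    have "inf (\<phi> p q) (\<phi> r s) \<le> lift_gen \<phi> (inf x y)" if "gen p q \<le> x" "gen r s \<le> y" for p q r s
    proof -
      have "gen (max p r) (min q s) = inf (gen p q) (gen r s)"
        by (rule real_relationsD(1)[OF real_relations_gen, symmetric])
      also have "\<dots> \<le> inf x y" using that by (rule inf_mono)
      finally have "\<phi> (max p r) (min q s) \<le> lift_gen \<phi> (inf x y)"
        unfolding lift_gen_def by (intro Sup_upper) blast
      then show ?thesis by (simp add: real_relationsD(1)[OF assms])
    qed
    then have "inf (\<phi> r s) (lift_gen \<phi> x) \<le> lift_gen \<phi> (inf x y)" if "gen r s \<le> y" for r s
      using that unfolding lift_gen_def[of \<phi> x] inf_Sup_frame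
      by (intro SUP_least) (auto simp: inf_commute)
    then have "inf (lift_gen \<phi> x) (lift_gen \<phi> y) \<le> lift_gen \<phi> (inf x y)"
      unfolding lift_gen_def[of \<phi> y] inf_Sup_frame
      by (intro SUP_least) (auto simp: inf_commute)
    then show "inf (lift_gen \<phi> x) (lift_gen \<phi> y) \<le> lift_gen \<phi> (inf x y)" .
  qed
next
  fix S
  show "lift_gen \<phi> (Sup S) = (SUP x\<in>S. lift_gen \<phi> x)"
  proof (rule antisym)
    define t where "t = (SUP x\<in>S. lift_gen \<phi> x)"
    define V where "V = {(p, q). \<phi> p q \<le> t}"
    have "real_ideal V"
    proof (rule real_idealI)
      fix p q r s assume "(p, q) \<in> V" "p \<le> r" "s \<le> q"
      then show "(r, s) \<in> V"
        using real_relations_mono[OF assms, of p r s q] by (auto simp: V_def intro: order_trans)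
    next
      fix p q r s assume A: "(p, q) \<in> V" "(r, s) \<in> V" "p \<le> r" "r < q" "q \<le> s"
      have "\<phi> p s = sup (\<phi> p q) (\<phi> r s)" using real_relationsD(2)[OF assms] A by simp
      then show "(p, s) \<in> V" using A by (simp add: V_def)
    next
      fix p q assume A: "\<And>r s. p < r \<Longrightarrow> r < s \<Longrightarrow> s < q \<Longrightarrow> (r, s) \<in> V"
      have "\<phi> p q = Sup {\<phi> r s | r s. p < r \<and> r < s \<and> s < q}"
        by (rule real_relationsD(3)[OF assms])
      also have "\<dots> \<le> t" using A by (intro Sup_least) (auto simp: V_def)
      finally show "(p, q) \<in> V" by (simp add: V_def)
    qed
    moreover have "\<Union>(ideal_of ` S) \<subseteq> V"
    proof
      fix z assume "z \<in> \<Union>(ideal_of ` S)"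
      then obtain x p q where z: "x \<in> S" "z = (p, q)" "(p, q) \<in> ideal_of x"
        by (metis UN_E surj_pair)
      have "\<phi> p q \<le> lift_gen \<phi> x"
        unfolding lift_gen_def by (rule Sup_upper) (use z in \<open>auto simp: gen_le_iff\<close>)
      also have "\<dots> \<le> t" unfolding t_def using z(1) by (rule SUP_upper)
      finally show "z \<in> V" using z by (simp add: V_def)
    qed
    ultimately have "ideal_of (Sup S) \<subseteq> V"
      unfolding Sup_frame_of_reals.rep_eq by (rule real_ideal_hull_least)
    then show "lift_gen \<phi> (Sup S) \<le> (SUP x\<in>S. lift_gen \<phi> x)"
      unfolding lift_gen_def[of \<phi> "Sup S"] t_def[symmetric]
      by (intro Sup_least) (auto simp: gen_le_iff V_def)
  next
    show "(SUP x\<in>S. lift_gen \<phi> x) \<le> lift_gen \<phi> (Sup S)"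
      unfolding lift_gen_def by (intro SUP_least Sup_subset_mono) (auto intro: Sup_upper2)
  qed
qed

lemma frame_hom_eq_lift_gen:
  assumes "frame_hom f"
  shows "f = lift_gen (\<lambda>p q. f (gen p q))"
proof
  fix x
  have "f x = f (Sup {gen p q | p q. gen p q \<le> x})"
    by (rule arg_cong[OF frame_of_reals_generated])
  also have "\<dots> = Sup (f ` {gen p q | p q. gen p q \<le> x})"
    using assms by (simp add: frame_hom_def)
  also have "f ` {gen p q | p q. gen p q \<le> x} = {f (gen p q) | p q. gen p q \<le> x}" by auto
  finally show "f x = lift_gen (\<lambda>p q. f (gen p q)) x" by (simp add: lift_gen_def)
qed

lemma real_relations_frame_hom:
  assumes "frame_hom f"
  shows "real_relations (\<lambda>p q. f (gen p q))"
proof -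
  have I: "f (inf x y) = inf (f x) (f y)" and S: "f (Sup A) = Sup (f ` A)" and T: "f top = top" for x y A
    using assms by (simp_all add: frame_hom_def)
  have J: "f (sup x y) = sup (f x) (f y)" for x y using S[of "{x, y}"] by simp
  note R = real_relationsD[OF real_relations_gen]
  show ?thesis
    unfolding real_relations_def
  proof (intro conjI allI impI)
    show "inf (f (gen p q)) (f (gen r s)) = f (gen (max p r) (min q s))" for p q r s
      by (simp only: I[symmetric] R(1))
    show "sup (f (gen p q)) (f (gen r s)) = f (gen p s)" if "p \<le> r \<and> r < q \<and> q \<le> s" for p q r s
      using R(2)[of p r q s] that by (simp only: J[symmetric])
    show "f (gen p q) = Sup {f (gen r s) | r s. p < r \<and> r < s \<and> s < q}" for p q
    proof -
      have "f (gen p q) = Sup (f ` {gen r s | r s. p < r \<and> r < s \<and> s < q})"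
        by (subst R(3)) (rule S)
      also have "f ` {gen r s | r s. p < r \<and> r < s \<and> s < q} =
          {f (gen r s) | r s. p < r \<and> r < s \<and> s < q}" by blast
      finally show ?thesis .
    qed
    have "top = Sup (f ` {gen p q | p q. True})"
      by (simp only: S[symmetric] R(4) T)
    also have "f ` {gen p q | p q. True} = {f (gen p q) | p q. True}" by blast
    finally show "top = Sup {f (gen p q) | p q. True}" .
  qed
qed

definition RL :: "(frame_of_reals \<Rightarrow> 'a::frame) set" where
  "RL = {\<alpha>. frame_hom \<alpha>}"

definition rat_ivl :: "rat \<Rightarrow> rat \<Rightarrow> real set" where
  "rat_ivl p q = {t. of_rat p < t \<and> t < of_rat q}"

text \<open>The operations and constants are prescribed on generators, where these prescriptions satisfy
  (R1)--(R4), and extended by \<open>lift_gen\<close>.\<close>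

definition rl_plus :: "(frame_of_reals \<Rightarrow> 'a::frame) \<Rightarrow> (frame_of_reals \<Rightarrow> 'a) \<Rightarrow> frame_of_reals \<Rightarrow> 'a" where
  "rl_plus \<alpha> \<beta> = lift_gen (\<lambda>p q. Sup {inf (\<alpha> (gen r s)) (\<beta> (gen u v)) | r s u v.
     {x + y | x y. x \<in> rat_ivl r s \<and> y \<in> rat_ivl u v} \<subseteq> rat_ivl p q})"

text \<open>The additive inverse in the ring of homomorphisms from the frame of reals to \<open>L\<close>:
  \<open>-t\<close> lies in \<open>(p, q)\<close> iff \<open>t\<close> lies in \<open>(-q, -p)\<close>.\<close>

definition rl_uminus :: "(frame_of_reals \<Rightarrow> 'a::frame) \<Rightarrow> frame_of_reals \<Rightarrow> 'a" where
  "rl_uminus \<alpha> = lift_gen (\<lambda>p q. \<alpha> (gen (- q) (- p)))"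

definition rl_minus :: "(frame_of_reals \<Rightarrow> 'a::frame) \<Rightarrow> (frame_of_reals \<Rightarrow> 'a) \<Rightarrow> frame_of_reals \<Rightarrow> 'a" where
  "rl_minus \<alpha> \<beta> = rl_plus \<alpha> (rl_uminus \<beta>)"

definition rl_const :: "real \<Rightarrow> frame_of_reals \<Rightarrow> 'a::frame" where
  "rl_const r = lift_gen (\<lambda>p q. if of_rat p < r \<and> r < of_rat q then top else bot)"

text \<open>\<open>gen_above p\<close> is \<open>(p, -)\<close> and \<open>gen_below q\<close> is \<open>(-, q)\<close>.\<close>

definition gen_above :: "rat \<Rightarrow> frame_of_reals" where
  "gen_above p = Sup {gen r s | r s. r > p \<and> s > p}"

definition gen_below :: "rat \<Rightarrow> frame_of_reals" where
  "gen_below q = Sup {gen r s | r s. r < q \<and> s < q}"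

definition coz :: "(frame_of_reals \<Rightarrow> 'a::frame) \<Rightarrow> 'a" where
  "coz \<alpha> = sup (\<alpha> (gen_below 0)) (\<alpha> (gen_above 0))"

definition R_set :: "(frame_of_reals \<Rightarrow> 'a::frame) \<Rightarrow> real set" where
  "R_set \<alpha> = {r. coz (rl_minus \<alpha> (rl_const r)) \<noteq> top}"

definition C_c :: "(frame_of_reals \<Rightarrow> 'a::frame) set" where
  "C_c = {\<alpha> \<in> RL. countable (R_set \<alpha>)}"

definition completely_regular :: "'a::frame itself \<Rightarrow> bool" where
  "completely_regular _ \<longleftrightarrow> (\<forall>a::'a. \<exists>A \<subseteq> RL. a = (SUP \<alpha>\<in>A. coz \<alpha>))"

text \<open>The set of these cozero elements with the order of \<open>L\<close>; joins, meets, top and bottom are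
  those of this ordered set, not those of \<open>L\<close>.\<close>

definition Coz_c :: "'a::frame itself \<Rightarrow> 'a gorder" where
  "Coz_c _ = \<lparr>carrier = coz ` C_c, eq = (=), le = (\<le>)\<rparr>"

locale sigma_frame = bounded_lattice M for M (structure) +
  assumes distrib: "\<lbrakk>x \<in> carrier M; y \<in> carrier M; z \<in> carrier M\<rbrakk> \<Longrightarrow>
      x \<sqinter> (y \<squnion> z) = (x \<sqinter> y) \<squnion> (x \<sqinter> z)"
    and countable_join_exists: "\<lbrakk>S \<subseteq> carrier M; countable S\<rbrakk> \<Longrightarrow> \<exists>s. is_lub M s S"
    and meet_countable_join: "\<lbrakk>a \<in> carrier M; S \<subseteq> carrier M; countable S\<rbrakk> \<Longrightarrow>
      a \<sqinter> \<Squnion>S = \<Squnion>((\<lambda>s. a \<sqinter> s) ` S)"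

definition rather_below :: "('a, 'm) gorder_scheme \<Rightarrow> 'a \<Rightarrow> 'a \<Rightarrow> bool" where
  "rather_below M a b \<longleftrightarrow>
     (\<exists>x \<in> carrier M. a \<sqinter>\<^bsub>M\<^esub> x = \<bottom>\<^bsub>M\<^esub> \<and> x \<squnion>\<^bsub>M\<^esub> b = \<top>\<^bsub>M\<^esub>)"

text \<open>Sequences are indexed from 0.\<close>

definition cover :: "('a, 'm) gorder_scheme \<Rightarrow> (nat \<Rightarrow> 'a) \<Rightarrow> bool" where
  "cover M a \<longleftrightarrow> range a \<subseteq> carrier M \<and> \<Squnion>\<^bsub>M\<^esub>(range a) = \<top>\<^bsub>M\<^esub>"

definition locally_finite_cover :: "('a, 'm) gorder_scheme \<Rightarrow> (nat \<Rightarrow> 'a) \<Rightarrow> bool" where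
  "locally_finite_cover M b \<longleftrightarrow> cover M b \<and>
     (\<exists>c P. cover M c \<and> (\<forall>m::nat. finite (P m) \<and> (\<forall>n. n \<notin> P m \<longrightarrow> c m \<sqinter>\<^bsub>M\<^esub> b n = \<bottom>\<^bsub>M\<^esub>)))"

definition paracompact :: "('a, 'm) gorder_scheme \<Rightarrow> bool" where
  "paracompact M \<longleftrightarrow> (\<forall>a. cover M a \<longrightarrow>
     (\<exists>b. locally_finite_cover M b \<and> (\<forall>m. \<exists>n. b m \<sqsubseteq>\<^bsub>M\<^esub> a n)))"

definition shrinkable :: "('a, 'm) gorder_scheme \<Rightarrow> (nat \<Rightarrow> 'a) \<Rightarrow> bool" where
  "shrinkable M a \<longleftrightarrow> (\<exists>d. cover M d \<and> (\<forall>n. rather_below M (d n) (a n)))"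

end

theory Submission
  imports Defs "HOL-Analysis.Continuum_Not_Denumerable"
begin

text \<open>The \<open>\<sigma>\<close>-frame \<open>Coz\<^sub>c[L]\<close> consists of the countable joins of complemented elements of \<open>L\<close>. Indeed, if
  \<open>coz (\<alpha> - r) = \<top>\<close>, then \<open>\<alpha>(-, r)\<close> and \<open>\<alpha>(r, -)\<close> are complements of each other; as \<open>R\<^sub>\<alpha>\<close> is countable,
  such \<open>r\<close> approach \<open>0\<close> from both sides, which exhausts \<open>coz \<alpha>\<close>. Conversely, a sequence of
  complemented elements has as its join the cozero element of a function with values \<open>1 / (n + 1)\<close> and
  \<open>0\<close>. Hence every cover \<open>(a\<^sub>n)\<close> is refined by a cover of pairwise disjoint complemented elements \<open>d\<^sub>j\<close>,
  where \<open>d\<^sub>j \<le> a\<^sub>n\<close> for \<open>n = f j\<close>. It is its own witness of local finiteness, and the joins of the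
  \<open>d\<^sub>j\<close> with \<open>f j = n\<close> shrink \<open>(a\<^sub>n)\<close>.\<close>

\<comment> \<open>Distributive laws in frames\<close>
subclass (in frame) distrib_lattice
proof
  fix x y z :: 'a
  \<comment> \<open>The frame law for a two-element set; the class asks for the dual law, which
    follows from this one by absorption.\<close>
  have D: "inf a (sup b c) = sup (inf a b) (inf a c)" for a b c
    using inf_Sup_frame[of a "{b, c}"] by simp
  have "inf (sup x y) (sup x z) = sup (inf (sup x y) x) (inf (sup x y) z)" by (rule D)
  also have "inf (sup x y) x = x" by (simp add: inf_commute)
  also have "inf (sup x y) z = sup (inf x z) (inf y z)" using D[of z x y] by (simp add: inf_commute)
  also have "sup x (sup (inf x z) (inf y z)) = sup x (inf y z)"
    by (simp add: sup_assoc[symmetric])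
  finally show "sup x (inf y z) = inf (sup x y) (sup x z)" by simp
qed

lemma Sup_inf_frame: "inf (Sup S) a = (SUP s\<in>S. inf s (a::'a::frame))"
  using inf_Sup_frame[of a S] by (simp add: inf_commute)

lemma inf_SUP_frame: "inf (a::'a::frame) (SUP i\<in>I. f i) = (SUP i\<in>I. inf a (f i))"
  by (simp add: inf_Sup_frame image_image)

lemma SUP_inf_frame: "inf (SUP i\<in>I. f i) (a::'a::frame) = (SUP i\<in>I. inf (f i) a)"
  by (simp add: Sup_inf_frame image_image)

subsection \<open>Complemented elements and their countable joins\<close>

definition complement_of :: "'a::frame \<Rightarrow> 'a \<Rightarrow> bool" where
  "complement_of a b \<longleftrightarrow> inf a b = bot \<and> sup a b = top"

definition complemented :: "'a::frame \<Rightarrow> bool" where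
  "complemented a \<longleftrightarrow> (\<exists>b. complement_of a b)"

lemma complement_of_sym: "complement_of a b \<Longrightarrow> complement_of b a"
  by (simp add: complement_of_def inf_commute sup_commute)

text \<open>De Morgan's law in a distributive lattice. Read through
  \<open>complement_of_sym\<close>, it also supplies complements of joins.\<close>

lemma complement_of_inf:
  assumes "complement_of a b" "complement_of c d"
  shows "complement_of (inf a c) (sup b d)"
proof -
  have "inf (inf a c) b = bot" using assms(1)
    by (metis complement_of_def inf.assoc inf.commute inf_bot_right)
  moreover have "inf (inf a c) d = bot" using assms(2)
    by (simp add: complement_of_def inf.assoc)
  moreover have "sup a (sup b d) = top" using assms(1)
    by (simp add: complement_of_def sup.assoc[symmetric])
  moreover have "sup c (sup b d) = top" using assms(2)
    by (metis complement_of_def sup.left_commute sup_top_right)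
  ultimately show ?thesis
    by (simp add: complement_of_def inf_sup_distrib1 sup_inf_distrib2)
qed

lemma complemented_inf: "complemented a \<Longrightarrow> complemented b \<Longrightarrow> complemented (inf a b)"
  unfolding complemented_def using complement_of_inf by blast

lemma complemented_bot: "complemented bot" and complemented_top: "complemented top"
  unfolding complemented_def complement_of_def by auto

text \<open>An intrinsic description of the carrier of \<open>Coz_c\<close>; the two are identified
  in \<open>coz_image_C_c\<close>.\<close>

definition sigma_complemented :: "'a::frame set" where
  "sigma_complemented = {Sup S | S. countable S \<and> (\<forall>s\<in>S. complemented s)}"

lemma sigma_complementedI:
  "countable S \<Longrightarrow> (\<And>s. s \<in> S \<Longrightarrow> complemented s) \<Longrightarrow> Sup S \<in> sigma_complemented"
  unfolding sigma_complemented_def by blast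

lemma complemented_imp_sigma: "complemented a \<Longrightarrow> a \<in> sigma_complemented"
  using sigma_complementedI[of "{a}"] by simp

text \<open>Choosing a countable family for each member of \<open>S\<close> flattens the double
  join, and a countable union of countable sets is countable.\<close>

lemma sigma_complemented_Sup:
  assumes "countable S" "S \<subseteq> sigma_complemented"
  shows "Sup S \<in> sigma_complemented"
proof -
  have "\<forall>s\<in>S. \<exists>T. countable T \<and> (\<forall>t\<in>T. complemented t) \<and> s = Sup T"
    using assms(2) by (auto simp: sigma_complemented_def)
  then obtain T where T: "\<And>s. s \<in> S \<Longrightarrow> countable (T s) \<and> (\<forall>t\<in>T s. complemented t) \<and> s = Sup (T s)"
    by metis
  have "Sup (\<Union>s\<in>S. T s) \<in> sigma_complemented"
    by (rule sigma_complementedI) (use assms(1) T in auto)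
  moreover have "Sup (\<Union>s\<in>S. T s) = Sup S"
  proof (rule antisym)
    show "Sup (\<Union>s\<in>S. T s) \<le> Sup S"
      using T by (intro Sup_least) (metis UN_E Sup_upper2 Sup_upper)
    show "Sup S \<le> Sup (\<Union>s\<in>S. T s)"
      using T by (intro Sup_least) (metis SUP_upper Sup_subset_mono UN_upper)
  qed
  ultimately show ?thesis by simp
qed

lemma sigma_complemented_sup:
  "a \<in> sigma_complemented \<Longrightarrow> b \<in> sigma_complemented \<Longrightarrow> sup a b \<in> sigma_complemented"
  using sigma_complemented_Sup[of "{a, b}"] by simp

lemma sigma_complemented_inf:
  assumes "a \<in> sigma_complemented" "b \<in> sigma_complemented"
  shows "inf a b \<in> sigma_complemented"
proof -
  obtain S T where S: "countable S" "\<forall>s\<in>S. complemented s" "a = Sup S"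
    and T: "countable T" "\<forall>t\<in>T. complemented t" "b = Sup T"
    using assms by (auto simp: sigma_complemented_def)
  have "inf s b \<in> sigma_complemented" if "s \<in> S" for s
    unfolding T(3) inf_Sup_frame
    by (rule sigma_complementedI) (use S T that complemented_inf in auto)
  then show ?thesis
    unfolding S(3) Sup_inf_frame by (intro sigma_complemented_Sup) (use S in auto)
qed

lemma sigma_complemented_sequence:
  assumes "a \<in> sigma_complemented"
  obtains c :: "nat \<Rightarrow> 'a::frame" where "\<And>n. complemented (c n)" "a = (SUP n. c n)"
proof -
  obtain S where S: "countable S" "\<forall>s\<in>S. complemented s" "a = Sup S"
    using assms by (auto simp: sigma_complemented_def)
  \<comment> \<open>Inserting \<open>bot\<close> leaves the join unchanged and makes the set
    nonempty, so that it can be enumerated even if \<open>S\<close> is empty.\<close>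
  let ?c = "from_nat_into (insert bot S)"
  have r: "range ?c = insert bot S" by (rule range_from_nat_into) (use S in auto)
  have "complemented (?c n)" for n
    using S(2) complemented_bot from_nat_into[of "insert bot S" n] by auto
  moreover have "a = (SUP n. ?c n)" using r S(3) by simp
  ultimately show thesis by (rule that)
qed

text \<open>The element \<open>w n\<close> is what the first \<open>n\<close> terms leave over. It
  serves both to make a sequence disjoint and to build a function in \<open>C_c\<close>. The
  segments are strict, so \<open>w 0\<close> is \<open>top\<close>.\<close>

lemma partial_join_complements:
  fixes a :: "nat \<Rightarrow> 'a::frame"
  assumes "\<And>n. complemented (a n)"
  obtains w where "\<And>n. complement_of (SUP i\<in>{..<n}. a i) (w n)"
proof -
  obtain c where c: "\<And>n. complement_of (a n) (c n)"
    using assms unfolding complemented_def by metis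
  have "\<exists>w. complement_of (SUP i\<in>{..<n}. a i) w" for n
  proof (induction n)
    case 0
    show ?case by (auto simp: complement_of_def)
  next
    case (Suc n)
    then obtain w where "complement_of (SUP i\<in>{..<n}. a i) w" by blast
    from complement_of_inf[OF c[of n, THEN complement_of_sym] this[THEN complement_of_sym]]
    have "complement_of (sup (a n) (SUP i\<in>{..<n}. a i)) (inf (c n) w)" by (rule complement_of_sym)
    then show ?case by (auto simp: lessThan_Suc)
  qed
  then show thesis using that by metis
qed

lemma complement_of_partial_join_disjoint:
  assumes "complement_of (SUP i\<in>{..<n}. a i) w" "i < n"
  shows "inf (a i) w = bot"
proof -
  have "inf (a i) w \<le> inf (SUP i\<in>{..<n}. a i) w" by (intro inf_mono SUP_upper) (use assms(2) in auto)
  also have "\<dots> = bot" using assms(1) by (simp add: complement_of_def)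
  finally show ?thesis by (simp add: bot_unique)
qed

text \<open>The usual disjointification: each term is cut down to the complement of the join of the
  earlier ones.\<close>

lemma disjoint_complemented_refinement:
  fixes a :: "nat \<Rightarrow> 'a::frame"
  assumes "\<And>n. complemented (a n)"
  obtains d where "\<And>n. complemented (d n)" "\<And>n. d n \<le> a n" "(SUP n. d n) = (SUP n. a n)"
    "\<And>m n. m \<noteq> n \<Longrightarrow> inf (d m) (d n) = bot"
proof -
  obtain w where w: "\<And>n. complement_of (SUP i\<in>{..<n}. a i) (w n)"
    using partial_join_complements[of a] assms by blast
  let ?d = "\<lambda>n. inf (a n) (w n)"
  show thesis
  proof
    show "complemented (?d n)" for n
      using assms w[THEN complement_of_sym] by (intro complemented_inf) (auto simp: complemented_def)
    show "?d n \<le> a n" for n by simp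
    \<comment> \<open>Nothing is lost by the cutting: \<open>a n\<close> splits along the preceding
      partial join and its complement \<open>w n\<close>. The first piece is covered by induction,
      the second is \<open>?d n\<close>.\<close>
    have le: "(SUP i\<in>{..<n}. a i) \<le> (SUP n. ?d n)" for n
    proof (induction n)
      case (Suc n)
      have "a n = inf (a n) (sup (SUP i\<in>{..<n}. a i) (w n))" using w[of n] by (simp add: complement_of_def)
      also have "\<dots> \<le> sup (SUP i\<in>{..<n}. a i) (?d n)"
        by (simp add: inf_sup_distrib1 le_supI1)
      also have "\<dots> \<le> (SUP n. ?d n)" using Suc by (rule sup_least) (rule SUP_upper2[of n], simp_all)
      finally show ?case using Suc by (simp add: lessThan_Suc)
    qed simp
    have "a n \<le> (SUP n. ?d n)" for n
      by (rule order_trans[OF SUP_upper le[of "Suc n"]]) simp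
    then show "(SUP n. ?d n) = (SUP n. a n)"
      by (intro antisym SUP_least SUP_upper2[OF _ inf.cobounded1]) auto
    have "inf (?d m) (?d n) = bot" if "m < n" for m n
    proof -
      have "inf (?d m) (?d n) \<le> inf (a m) (w n)" by (auto intro: inf.coboundedI1 inf.coboundedI2)
      then show ?thesis using complement_of_partial_join_disjoint[OF w that] by (simp add: bot_unique)
    qed
    then show "inf (?d m) (?d n) = bot" if "m \<noteq> n" for m n
      using that by (metis inf_commute nat_neq_iff)
  qed
qed

subsection \<open>Cozero elements of translates\<close>

text \<open>The generators below \<open>gen p q\<close> are the degenerate ones and those with
  endpoints inside, so monotonicity and the value \<open>bot\<close> on degenerate pairs suffice.
  This evaluates constants and their negatives directly.\<close>

lemma lift_gen_gen_mono:
  assumes "\<And>p q r s. p \<le> r \<Longrightarrow> s \<le> q \<Longrightarrow> \<phi> r s \<le> \<phi> p q" "\<And>p q. q \<le> p \<Longrightarrow> \<phi> p q = bot"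
  shows "lift_gen \<phi> (gen p q) = \<phi> p q"
proof (rule antisym)
  show "lift_gen \<phi> (gen p q) \<le> \<phi> p q"
    unfolding lift_gen_def by (rule Sup_least) (auto simp: gen_le_gen_iff assms)
qed (auto simp: lift_gen_def intro!: Sup_upper)

lemma rl_const_gen:
  "rl_const r (gen p q) = (if of_rat p < r \<and> r < of_rat q then top else bot :: 'a::frame)"
  unfolding rl_const_def
proof (rule lift_gen_gen_mono)
  fix p q r' s :: rat assume "p \<le> r'" "s \<le> q"
  then have "real_of_rat p \<le> of_rat r'" "real_of_rat s \<le> of_rat q" by (simp_all add: of_rat_less_eq)
  then show "(if of_rat r' < r \<and> r < of_rat s then top else bot :: 'a)
      \<le> (if of_rat p < r \<and> r < of_rat q then top else bot)" by auto
next
  fix p q :: rat assume "q \<le> p"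
  then have "real_of_rat q \<le> of_rat p" by (simp add: of_rat_less_eq)
  then show "(if of_rat p < r \<and> r < of_rat q then top else bot :: 'a) = bot" by auto
qed

lemma rl_uminus_const_gen:
  "rl_uminus (rl_const r) (gen p q) = (if of_rat p < - r \<and> - r < of_rat q then top else bot :: 'a::frame)"
proof -
  have "rl_uminus (rl_const r) (gen p q) = (rl_const r (gen (- q) (- p)) :: 'a)"
    unfolding rl_uminus_def
  proof (rule lift_gen_gen_mono)
    fix p q r' s :: rat assume "p \<le> r'" "s \<le> q"
    then have "real_of_rat p \<le> of_rat r'" "real_of_rat s \<le> of_rat q" by (simp_all add: of_rat_less_eq)
    then show "rl_const r (gen (- s) (- r')) \<le> (rl_const r (gen (- q) (- p)) :: 'a)"
      by (auto simp: rl_const_gen of_rat_minus)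
  next
    fix p q :: rat assume "q \<le> p"
    then have "real_of_rat q \<le> of_rat p" by (simp add: of_rat_less_eq)
    then show "rl_const r (gen (- q) (- p)) = (bot :: 'a)"
      by (auto simp: rl_const_gen of_rat_minus)
  qed
  then show ?thesis by (auto simp: rl_const_gen of_rat_minus)
qed

lemma gen_le_gen_below_iff: "gen p q \<le> gen_below b \<longleftrightarrow> q \<le> p \<or> q \<le> b"
proof
  assume L: "gen p q \<le> gen_below b"
  \<comment> \<open>This ideal contains every generator joined in \<open>gen_below b\<close>, hence
    bounds that join from above, and membership in it can be read off.\<close>
  let ?U = "{(r, s). s \<le> r \<or> s \<le> b}"
  have U: "real_ideal ?U"
  proof (rule real_idealI)
    fix p q :: rat
    assume A: "\<And>r s. p < r \<Longrightarrow> r < s \<Longrightarrow> s < q \<Longrightarrow> (r, s) \<in> ?U"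
    show "(p, q) \<in> ?U"
    proof (cases "p < q")
      case True
      have "q \<le> b"
      proof (rule dense_le_bounded[OF True])
        fix s assume s: "p < s" "s < q"
        then obtain r where "p < r" "r < s" using dense by blast
        then show "s \<le> b" using A[of r s] s by auto
      qed
      then show ?thesis by simp
    qed auto
  qed auto
  have "gen_below b \<le> Abs_frame_of_reals ?U"
    unfolding gen_below_def
    by (rule Sup_least) (auto simp: gen_le_iff Abs_frame_of_reals_inverse U)
  with L have "gen p q \<le> Abs_frame_of_reals ?U" by (rule order_trans)
  then show "q \<le> p \<or> q \<le> b" by (simp add: gen_le_iff Abs_frame_of_reals_inverse U)
next
  assume A: "q \<le> p \<or> q \<le> b"
  have "(p, q) \<in> ideal_of (gen_below b)"
  \<comment> \<open>By (R3) only strictly inner pairs matter; their right endpoint is strictly below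
    \<open>b\<close>, as \<open>gen_below\<close> demands.\<close>
  proof (rule real_idealD(3)[OF real_ideal_ideal_of])
    fix r s assume "p < r" "r < s" "s < q"
    then show "(r, s) \<in> ideal_of (gen_below b)"
      unfolding gen_le_iff[symmetric] gen_below_def using A by (intro Sup_upper) force
  qed
  then show "gen p q \<le> gen_below b" by (simp add: gen_le_iff)
qed

lemma gen_le_gen_above_iff: "gen p q \<le> gen_above a \<longleftrightarrow> q \<le> p \<or> a \<le> p"
proof
  assume L: "gen p q \<le> gen_above a"
  let ?U = "{(r, s). s \<le> r \<or> a \<le> r}"
  have U: "real_ideal ?U"
  proof (rule real_idealI)
    fix p q :: rat
    assume A: "\<And>r s. p < r \<Longrightarrow> r < s \<Longrightarrow> s < q \<Longrightarrow> (r, s) \<in> ?U"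
    show "(p, q) \<in> ?U"
    proof (cases "p < q")
      case True
      have "a \<le> p"
      proof (rule dense_ge_bounded[OF True])
        fix r assume r: "p < r" "r < q"
        then obtain s where "r < s" "s < q" using dense by blast
        then show "a \<le> r" using A[of r s] r by auto
      qed
      then show ?thesis by simp
    qed auto
  qed auto
  have "gen_above a \<le> Abs_frame_of_reals ?U"
    unfolding gen_above_def
    by (rule Sup_least) (auto simp: gen_le_iff Abs_frame_of_reals_inverse U)
  with L have "gen p q \<le> Abs_frame_of_reals ?U" by (rule order_trans)
  then show "q \<le> p \<or> a \<le> p" by (simp add: gen_le_iff Abs_frame_of_reals_inverse U)
next
  assume A: "q \<le> p \<or> a \<le> p"
  have "(p, q) \<in> ideal_of (gen_above a)"
  proof (rule real_idealD(3)[OF real_ideal_ideal_of])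
    fix r s assume "p < r" "r < s" "s < q"
    then show "(r, s) \<in> ideal_of (gen_above a)"
      unfolding gen_le_iff[symmetric] gen_above_def using A by (intro Sup_upper) force
  qed
  then show "gen p q \<le> gen_above a" by (simp add: gen_le_iff)
qed

section \<open>Values of a homomorphism on rays with real endpoints\<close>

definition lower_part :: "(frame_of_reals \<Rightarrow> 'a::frame) \<Rightarrow> real \<Rightarrow> 'a" where
  "lower_part \<alpha> t = Sup {\<alpha> (gen p q) | p q. of_rat q < t}"

definition upper_part :: "(frame_of_reals \<Rightarrow> 'a::frame) \<Rightarrow> real \<Rightarrow> 'a" where
  "upper_part \<alpha> t = Sup {\<alpha> (gen p q) | p q. t < of_rat p}"

lemma lower_part_upper: "of_rat q < t \<Longrightarrow> \<alpha> (gen p q) \<le> lower_part \<alpha> t"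
  unfolding lower_part_def by (rule Sup_upper) blast

lemma upper_part_upper: "t < of_rat p \<Longrightarrow> \<alpha> (gen p q) \<le> upper_part \<alpha> t"
  unfolding upper_part_def by (rule Sup_upper) blast

text \<open>Inclusion of intervals gives inequalities of endpoints only if the smaller one is
  nonempty, whence \<open>a < b\<close>; the endpoints are then approached from inside.\<close>

lemma rat_ivl_nonempty_subsetD:
  assumes "\<And>x. a < x \<Longrightarrow> x < b \<Longrightarrow> x - t \<in> rat_ivl p q" "a < b"
  shows "of_rat p \<le> a - t" "b - t \<le> of_rat q" "p < q"
proof -
  have *: "of_rat p < x - t" "x - t < of_rat q" if "a < x" "x < b" for x
    using assms(1)[OF that] by (auto simp: rat_ivl_def)
  have "of_rat p + t \<le> a" by (rule dense_ge_bounded[OF \<open>a < b\<close>]) (use * in fastforce)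
  then show "of_rat p \<le> a - t" by simp
  have "b \<le> of_rat q + t" by (rule dense_le_bounded[OF \<open>a < b\<close>]) (use * in fastforce)
  then show "b - t \<le> of_rat q" by simp
  obtain x where "a < x" "x < b" using dense \<open>a < b\<close> by blast
  with * have "real_of_rat p < of_rat q" by fastforce
  then show "p < q" by (simp add: of_rat_less)
qed

context
  fixes \<alpha> :: "frame_of_reals \<Rightarrow> 'a::frame"
  assumes hom: "frame_hom \<alpha>"
begin

private lemma R: "real_relations (\<lambda>p q. \<alpha> (gen p q))"
  by (rule real_relations_frame_hom[OF hom])

lemma hom_gen_below: "\<alpha> (gen_below b) = lower_part \<alpha> (of_rat b)"
proof (rule antisym)
  have "\<alpha> (gen_below b) = Sup (\<alpha> ` {gen r s | r s. r < b \<and> s < b})"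
    using hom by (simp add: gen_below_def frame_hom_def)
  also have "\<dots> \<le> lower_part \<alpha> (of_rat b)"
    by (rule Sup_least) (auto intro!: lower_part_upper simp: of_rat_less)
  finally show "\<alpha> (gen_below b) \<le> lower_part \<alpha> (of_rat b)" .
next
  have "\<alpha> (gen p q) \<le> \<alpha> (gen_below b)" if "q < b" for p q
  proof -
    have "inf (gen p q) (gen_below b) = gen p q"
      using that by (intro inf_absorb1) (simp add: gen_le_gen_below_iff)
    then show ?thesis using hom by (metis frame_hom_def inf.cobounded2)
  qed
  then show "lower_part \<alpha> (of_rat b) \<le> \<alpha> (gen_below b)"
    unfolding lower_part_def by (intro Sup_least) (auto simp: of_rat_less)
qed

lemma hom_gen_above: "\<alpha> (gen_above a) = upper_part \<alpha> (of_rat a)"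
proof (rule antisym)
  have "\<alpha> (gen_above a) = Sup (\<alpha> ` {gen r s | r s. r > a \<and> s > a})"
    using hom by (simp add: gen_above_def frame_hom_def)
  also have "\<dots> \<le> upper_part \<alpha> (of_rat a)"
    by (rule Sup_least) (auto intro!: upper_part_upper simp: of_rat_less)
  finally show "\<alpha> (gen_above a) \<le> upper_part \<alpha> (of_rat a)" .
next
  have "\<alpha> (gen p q) \<le> \<alpha> (gen_above a)" if "a < p" for p q
  proof -
    have "inf (gen p q) (gen_above a) = gen p q"
      using that by (intro inf_absorb1) (simp add: gen_le_gen_above_iff)
    then show ?thesis using hom by (metis frame_hom_def inf.cobounded2)
  qed
  then show "upper_part \<alpha> (of_rat a) \<le> \<alpha> (gen_above a)"
    unfolding upper_part_def by (intro Sup_least) (auto simp: of_rat_less)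
qed

lemma coz_conv_parts: "coz \<alpha> = sup (lower_part \<alpha> 0) (upper_part \<alpha> 0)"
  using hom_gen_below[of 0] hom_gen_above[of 0] by (simp add: coz_def)

text \<open>By (R1), two generators on opposite sides of \<open>t\<close> meet in a degenerate pair,
  which is \<open>bot\<close>.\<close>

lemma lower_inf_upper_part: "inf (lower_part \<alpha> t) (upper_part \<alpha> t) = bot"
proof -
  have "inf (\<alpha> (gen p q)) (\<alpha> (gen r s)) = bot" if "of_rat q < t" "t < of_rat r" for p q r s
  proof -
    have "real_of_rat q < of_rat r" using that by linarith
    then have "min q s \<le> max p r" by (simp add: of_rat_less)
    then show ?thesis
      using real_relationsD(1)[OF R, of p q r s] real_relations_degenerate[OF R] by simp
  qed
  then show ?thesis
    unfolding lower_part_def upper_part_def inf_Sup_frame Sup_inf_frame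
    by (auto simp: image_image intro!: antisym SUP_least)
qed

text \<open>The join defining \<open>lower_part\<close> asks for strict inequality; (R3) extends the
  bound to the boundary case, since \<open>gen p q\<close> is the join of generators with smaller
  right endpoint.\<close>

lemma le_lower_part: 
  assumes "of_rat q \<le> t"
  shows "\<alpha> (gen p q) \<le> lower_part \<alpha> t"
proof -
  have "\<alpha> (gen r s) \<le> lower_part \<alpha> t" if "s < q" for r s
  proof (rule lower_part_upper)
    have "real_of_rat s < of_rat q" using that by (simp add: of_rat_less)
    then show "of_rat s < t" using assms by linarith
  qed
  then show ?thesis by (subst real_relationsD(3)[OF R]) (auto intro!: Sup_least)
qed

lemma le_upper_part:
  assumes "t \<le> of_rat p"
  shows "\<alpha> (gen p q) \<le> upper_part \<alpha> t"
proof -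
  have "\<alpha> (gen r s) \<le> upper_part \<alpha> t" if "p < r" for r s
  proof (rule upper_part_upper)
    have "real_of_rat p < of_rat r" using that by (simp add: of_rat_less)
    then show "t < of_rat r" using assms by linarith
  qed
  then show ?thesis by (subst real_relationsD(3)[OF R]) (auto intro!: Sup_least)
qed

text \<open>One summand takes only the values \<open>top\<close> and \<open>bot\<close> on
  generators, so the sum formula reduces to a translation by \<open>- t\<close>. The extension
  \<open>lift_gen \<phi>\<close> is evaluated on the two rays straight from its definition as a
  join.\<close>

lemma coz_minus_const: "coz (rl_minus \<alpha> (rl_const t)) = sup (lower_part \<alpha> t) (upper_part \<alpha> t)"
proof -
  define \<beta> :: "frame_of_reals \<Rightarrow> 'a" where "\<beta> = rl_uminus (rl_const t)"
  have \<beta>: "\<beta> (gen c d) = (if of_rat c < - t \<and> - t < of_rat d then top else bot)" for c d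
    unfolding \<beta>_def by (rule rl_uminus_const_gen)
  define \<phi> where "\<phi> p q = Sup {inf (\<alpha> (gen r s)) (\<beta> (gen u v)) | r s u v.
     {x + y | x y. x \<in> rat_ivl r s \<and> y \<in> rat_ivl u v} \<subseteq> rat_ivl p q}" for p q
  have minus: "rl_minus \<alpha> (rl_const t) = lift_gen \<phi>"
    by (simp add: rl_minus_def rl_plus_def \<beta>_def \<phi>_def[abs_def])
  \<comment> \<open>Terms with \<open>s \<le> r\<close>, or with \<open>- t\<close> outside the
    interval of \<open>u\<close> and \<open>v\<close>, are \<open>bot\<close>. In the others the
    interval of \<open>r\<close> and \<open>s\<close>, shifted by \<open>- t\<close>, lies inside
    that of \<open>p\<close> and \<open>q\<close>.\<close>
  have \<phi>_le: "\<phi> p q \<le> z"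
    if z: "\<And>r s. p < q \<Longrightarrow> of_rat p \<le> of_rat r - t \<Longrightarrow> of_rat s - t \<le> of_rat q \<Longrightarrow> \<alpha> (gen r s) \<le> z"
    for p q z
    unfolding \<phi>_def
  proof (rule Sup_least, clarify)
    fix r s u v
    assume sub: "{x + y | x y. x \<in> rat_ivl r s \<and> y \<in> rat_ivl u v} \<subseteq> rat_ivl p q"
    show "inf (\<alpha> (gen r s)) (\<beta> (gen u v)) \<le> z"
    proof (cases "r < s \<and> of_rat u < - t \<and> - t < of_rat v")
      case True
      have "x - t \<in> rat_ivl p q" if "of_rat r < x" "x < of_rat s" for x
      proof -
        have "x \<in> rat_ivl r s" "- t \<in> rat_ivl u v" using that True by (auto simp: rat_ivl_def)
        then have "x + - t \<in> {x + y | x y. x \<in> rat_ivl r s \<and> y \<in> rat_ivl u v}" by blast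
        then show ?thesis using sub by auto
      qed
      from rat_ivl_nonempty_subsetD[OF this] True have "\<alpha> (gen r s) \<le> z"
        by (intro z) (auto simp: of_rat_less)
      then show ?thesis by (rule le_infI1)
    next
      case False
      then have "\<alpha> (gen r s) = bot \<or> \<beta> (gen u v) = bot"
        using real_relations_degenerate[OF R, of s r] \<beta> by auto
      then show ?thesis by auto
    qed
  qed
  have le_\<phi>: "\<alpha> (gen r s) \<le> \<phi> (r + u) (s + v)" if "of_rat u < - t" "- t < of_rat v" for r s u v
  proof -
    have "inf (\<alpha> (gen r s)) (\<beta> (gen u v)) \<le> \<phi> (r + u) (s + v)"
      unfolding \<phi>_def by (rule Sup_upper) (force simp: rat_ivl_def of_rat_add)
    then show ?thesis using that by (simp add: \<beta>)
  qed
  have "lift_gen \<phi> (gen_below 0) = lower_part \<alpha> t"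
  proof (rule antisym)
    show "lift_gen \<phi> (gen_below 0) \<le> lower_part \<alpha> t"
      unfolding lift_gen_def
    proof (rule Sup_least, clarify)
      fix p q assume "gen p q \<le> gen_below 0"
      then have "q \<le> p \<or> q \<le> 0" by (simp add: gen_le_gen_below_iff)
      then have "p < q \<Longrightarrow> real_of_rat q \<le> 0" by simp
      then show "\<phi> p q \<le> lower_part \<alpha> t" by (intro \<phi>_le le_lower_part) linarith
    qed
    show "lower_part \<alpha> t \<le> lift_gen \<phi> (gen_below 0)"
      unfolding lower_part_def
    proof (rule Sup_least, clarify)
      fix r s assume "of_rat s < t"
      then have "- t < - of_rat s" by simp
      \<comment> \<open>The right endpoint \<open>v\<close> is taken close enough to
        \<open>- t\<close> to make \<open>s + v\<close> negative. The left endpoint \<open>u\<close>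
        may be anything below \<open>- t\<close>, as it does not affect membership in a lower
        ray.\<close>
      then obtain v where v: "- t < of_rat v" "real_of_rat v < - of_rat s" using of_rat_dense by blast
      obtain u where u: "real_of_rat u < - t" using of_rat_dense[of "- t - 1" "- t"] by auto
      have "real_of_rat (s + v) < 0" using v by (simp add: of_rat_add)
      then have "s + v \<le> 0" by simp
      then have "\<phi> (r + u) (s + v) \<le> lift_gen \<phi> (gen_below 0)"
        unfolding lift_gen_def by (intro Sup_upper) (auto simp: gen_le_gen_below_iff)
      with le_\<phi>[OF u v(1)] show "\<alpha> (gen r s) \<le> lift_gen \<phi> (gen_below 0)" by (rule order_trans)
    qed
  qed
  moreover have "lift_gen \<phi> (gen_above 0) = upper_part \<alpha> t"
  proof (rule antisym)
    show "lift_gen \<phi> (gen_above 0) \<le> upper_part \<alpha> t"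
      unfolding lift_gen_def
    proof (rule Sup_least, clarify)
      fix p q assume "gen p q \<le> gen_above 0"
      then have "q \<le> p \<or> 0 \<le> p" by (simp add: gen_le_gen_above_iff)
      then have "p < q \<Longrightarrow> 0 \<le> real_of_rat p" by simp
      then show "\<phi> p q \<le> upper_part \<alpha> t" by (intro \<phi>_le le_upper_part) linarith
    qed
    show "upper_part \<alpha> t \<le> lift_gen \<phi> (gen_above 0)"
      unfolding upper_part_def
    proof (rule Sup_least, clarify)
      fix r s assume "t < of_rat r"
      then have "- of_rat r < - t" by simp
      then obtain u where u: "- of_rat r < real_of_rat u" "of_rat u < - t" using of_rat_dense by blast
      obtain v where v: "- t < real_of_rat v" using of_rat_dense[of "- t" "- t + 1"] by auto
      have "0 < real_of_rat (r + u)" using u by (simp add: of_rat_add)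
      then have "0 \<le> r + u" by simp
      then have "\<phi> (r + u) (s + v) \<le> lift_gen \<phi> (gen_above 0)"
        unfolding lift_gen_def by (intro Sup_upper) (auto simp: gen_le_gen_above_iff)
      with le_\<phi>[OF u(2) v] show "\<alpha> (gen r s) \<le> lift_gen \<phi> (gen_above 0)" by (rule order_trans)
    qed
  qed
  ultimately show ?thesis by (simp add: coz_def minus)
qed

lemma notin_R_set_iff: "t \<notin> R_set \<alpha> \<longleftrightarrow> sup (lower_part \<alpha> t) (upper_part \<alpha> t) = top"
  by (simp add: R_set_def coz_minus_const)

lemma complement_of_parts: "t \<notin> R_set \<alpha> \<Longrightarrow> complement_of (lower_part \<alpha> t) (upper_part \<alpha> t)"
  by (simp add: complement_of_def notin_R_set_iff lower_inf_upper_part)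

end

lemma lower_part_mono: "s \<le> t \<Longrightarrow> lower_part \<alpha> s \<le> lower_part \<alpha> t"
  unfolding lower_part_def by (intro Sup_subset_mono) force

lemma upper_part_antimono: "s \<le> t \<Longrightarrow> upper_part \<alpha> t \<le> upper_part \<alpha> s"
  unfolding upper_part_def by (intro Sup_subset_mono) force

section \<open>Cozero elements of functions in \<open>C_c\<close>\<close>

lemma coz_C_c_sigma_complemented:
  assumes "\<alpha> \<in> C_c"
  shows "coz \<alpha> \<in> sigma_complemented"
proof -
  have hom: "frame_hom \<alpha>" and C: "countable (R_set \<alpha>)" using assms by (auto simp: C_c_def RL_def)
  \<comment> \<open>A nonempty open interval of reals is uncountable and cannot lie in the countable
    \<open>R_set \<alpha>\<close>.\<close>
  have dense: "\<exists>t. a < t \<and> t < b \<and> t \<notin> R_set \<alpha>" if "a < b" for a b :: real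
  proof -
    have "\<not> {a<..<b} \<subseteq> R_set \<alpha>"
      using that C uncountable_open_interval[of a b] countable_subset by blast
    then show ?thesis by auto
  qed
  \<comment> \<open>The bounds \<open>1 / (n + 1)\<close> force \<open>u n\<close>, and
    \<open>l n\<close> below, to tend to 0, so the rays at these points exhaust the rays at
    0.\<close>
  have "\<forall>n. \<exists>t. 0 < t \<and> t < inverse (real (Suc n)) \<and> t \<notin> R_set \<alpha>"
    using dense by simp
  then obtain u where u: "\<And>n. 0 < u n \<and> u n < inverse (real (Suc n)) \<and> u n \<notin> R_set \<alpha>" by metis
  have "\<forall>n. \<exists>t. - inverse (real (Suc n)) < t \<and> t < 0 \<and> t \<notin> R_set \<alpha>"
    using dense by simp
  then obtain l where l: "\<And>n. - inverse (real (Suc n)) < l n \<and> l n < 0 \<and> l n \<notin> R_set \<alpha>" by metis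
  have "lower_part \<alpha> 0 = (SUP n. lower_part \<alpha> (l n))"
  proof (rule antisym)
    have "\<alpha> (gen p q) \<le> (SUP n. lower_part \<alpha> (l n))" if q: "real_of_rat q < 0" for p q
    proof -
      obtain n where "inverse (real (Suc n)) < - of_rat q" using reals_Archimedean[of "- of_rat q"] q by auto
      then have "of_rat q < l n" using l[of n] by linarith
      then show ?thesis by (intro SUP_upper2[of n UNIV, OF UNIV_I] lower_part_upper)
    qed
    then show "lower_part \<alpha> 0 \<le> (SUP n. lower_part \<alpha> (l n))"
      by (subst lower_part_def) (auto intro!: Sup_least)
    show "(SUP n. lower_part \<alpha> (l n)) \<le> lower_part \<alpha> 0"
      by (intro SUP_least lower_part_mono) (use l less_imp_le in blast)
  qed
  moreover have "upper_part \<alpha> 0 = (SUP n. upper_part \<alpha> (u n))"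
  proof (rule antisym)
    have "\<alpha> (gen p q) \<le> (SUP n. upper_part \<alpha> (u n))" if p: "0 < real_of_rat p" for p q
    proof -
      obtain n where "inverse (real (Suc n)) < of_rat p" using reals_Archimedean[OF p] by blast
      then have "u n < of_rat p" using u[of n] by linarith
      then show ?thesis by (intro SUP_upper2[of n UNIV, OF UNIV_I] upper_part_upper)
    qed
    then show "upper_part \<alpha> 0 \<le> (SUP n. upper_part \<alpha> (u n))"
      by (subst upper_part_def) (auto intro!: Sup_least)
    show "(SUP n. upper_part \<alpha> (u n)) \<le> upper_part \<alpha> 0"
      by (intro SUP_least upper_part_antimono) (use u less_imp_le in blast)
  qed
  moreover have "complemented (lower_part \<alpha> (l n))" "complemented (upper_part \<alpha> (u n))" for n
    using complement_of_parts[OF hom] l u complement_of_sym unfolding complemented_def by blast+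
  ultimately show ?thesis
    unfolding coz_conv_parts[OF hom]
    by (auto intro!: sigma_complemented_sup sigma_complementedI)
qed

subsection \<open>Real-valued homomorphisms from scales\<close>

text \<open>The families \<open>A\<close> and \<open>B\<close> form a frame-valued Dedekind cut,
  with \<open>A p\<close> in the role of (p, -) and \<open>B q\<close> in that of (-, q).
  Monotonicity, contained in roundedness, gives (R1); with \<open>cov\<close> it gives (R2);
  roundedness and \<open>disj\<close> give (R3), and the conditions on the total joins give
  (R4).\<close>

lemma real_relations_scale:
  fixes A B :: "rat \<Rightarrow> 'a::frame"
  assumes disj: "\<And>p. inf (A p) (B p) = bot"
    and cov: "\<And>p q. p < q \<Longrightarrow> sup (A p) (B q) = top"
    and A: "\<And>p. A p = (SUP r\<in>{p<..}. A r)" and B: "\<And>q. B q = (SUP s\<in>{..<q}. B s)"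
    and A_top: "(SUP p. A p) = top" and B_top: "(SUP q. B q) = top"
  shows "real_relations (\<lambda>p q. inf (A p) (B q))"
proof -
  have Am: "A r \<le> A p" if "p \<le> r" for p r
    by (subst (1 2) A) (intro SUP_subset_mono, use that in auto)
  have Bm: "B p \<le> B r" if "p \<le> r" for p r
    by (subst (1 2) B) (intro SUP_subset_mono, use that in auto)
  have A_max: "inf (A p) (A r) = A (max p r)" for p r
    by (metis Am inf.absorb1 inf.absorb2 linear max.absorb1 max.absorb2)
  have B_min: "inf (B p) (B r) = B (min p r)" for p r
    by (metis Bm inf.absorb1 inf.absorb2 linear min.absorb1 min.absorb2)
  have AB: "inf (A p) (B q) = bot" if "q \<le> p" for p q
    using disj[of p] Bm[OF that] by (metis bot_unique inf_mono order_refl)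
  show ?thesis
    unfolding real_relations_def
  proof (intro conjI allI impI)
    fix p q r s
    show "inf (inf (A p) (B q)) (inf (A r) (B s)) = inf (A (max p r)) (B (min q s))"
      by (metis A_max B_min inf.assoc inf.left_commute)
  next
    fix p q r s :: rat assume h: "p \<le> r \<and> r < q \<and> q \<le> s"
    have "A r \<le> A p" "B q \<le> B s" using h Am Bm by auto
    \<comment> \<open>Expanding by distributivity produces four joins: two collapse to
      \<open>A p\<close> and \<open>B s\<close> by monotonicity, the other two are
      \<open>top\<close> by \<open>cov\<close>, because \<open>p < s\<close> and
      \<open>r < q\<close>.\<close>
    then have "sup (inf (A p) (B q)) (inf (A r) (B s)) =
        inf (inf (A p) (B s)) (inf (sup (A p) (B s)) (sup (A r) (B q)))"
      by (simp add: sup_inf_distrib1 sup_inf_distrib2 sup_absorb1 sup_absorb2 inf_assoc inf_commute inf_left_commute sup_commute)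
    also have "\<dots> = inf (A p) (B s)"
      using cov[of r q] cov[of p s] h by simp
    finally show "sup (inf (A p) (B q)) (inf (A r) (B s)) = inf (A p) (B s)" .
  next
    fix p q
    let ?S = "Sup {inf (A r) (B s) | r s. p < r \<and> r < s \<and> s < q}"
    show "inf (A p) (B q) = ?S"
    proof (rule antisym)
      have "inf (A r) (B s) \<le> ?S" if "p < r" "s < q" for r s
      proof (cases "r < s")
        case True
        then show ?thesis by (intro Sup_upper) (use that in blast)
      next
        case False
        then show ?thesis using AB by simp
      qed
      then show "inf (A p) (B q) \<le> ?S"
        by (subst A, subst B) (auto simp: inf_SUP_frame SUP_inf_frame intro!: SUP_least)
      show "?S \<le> inf (A p) (B q)"
        by (rule Sup_least, clarify) (intro inf_mono Am Bm, simp_all)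
    qed
  next
    have "top = inf (SUP p. A p) (SUP q. B q)" by (simp add: A_top B_top)
    also have "\<dots> \<le> Sup {inf (A p) (B q) | p q. True}"
      unfolding inf_SUP_frame SUP_inf_frame by (intro SUP_least Sup_upper) auto
    finally show "top = Sup {inf (A p) (B q) | p q. True}" by (simp add: top_unique)
  qed
qed

text \<open>On a ray one endpoint of the generators is unrestricted, and the join over it is
  \<open>top\<close> and drops out of the meet.\<close>

lemma parts_lift_gen_scale:
  fixes A B :: "rat \<Rightarrow> 'a::frame"
  assumes R: "real_relations (\<lambda>p q. inf (A p) (B q))"
    and A_top: "(SUP p. A p) = top" and B_top: "(SUP q. B q) = top"
  shows "lower_part (lift_gen (\<lambda>p q. inf (A p) (B q))) t = (SUP q\<in>{q. of_rat q < t}. B q)"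
    and "upper_part (lift_gen (\<lambda>p q. inf (A p) (B q))) t = (SUP p\<in>{p. t < of_rat p}. A p)"
proof -
  have "lower_part (lift_gen (\<lambda>p q. inf (A p) (B q))) t = (SUP q\<in>{q. of_rat q < t}. SUP p. inf (A p) (B q))"
    unfolding lower_part_def lift_gen_gen[OF R]
    by (auto intro!: antisym Sup_least SUP_least intro: SUP_upper2 Sup_upper)
  also have "\<dots> = inf (SUP p. A p) (SUP q\<in>{q. of_rat q < t}. B q)"
    by (simp only: SUP_inf_frame inf_SUP_frame)
  finally show "lower_part (lift_gen (\<lambda>p q. inf (A p) (B q))) t = (SUP q\<in>{q. of_rat q < t}. B q)"
    by (simp add: A_top)
  have "upper_part (lift_gen (\<lambda>p q. inf (A p) (B q))) t = (SUP q. SUP p\<in>{p. t < of_rat p}. inf (A p) (B q))"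
    unfolding upper_part_def lift_gen_gen[OF R]
    by (auto intro!: antisym Sup_least SUP_least intro: SUP_upper2 Sup_upper)
  also have "\<dots> = inf (SUP p\<in>{p. t < of_rat p}. A p) (SUP q. B q)"
    by (simp only: SUP_inf_frame inf_SUP_frame)
  finally show "upper_part (lift_gen (\<lambda>p q. inf (A p) (B q))) t = (SUP p\<in>{p. t < of_rat p}. A p)"
    by (simp add: B_top)
qed

text \<open>The witness is the function with value \<open>1 / (n + 1)\<close> on \<open>c n\<close> minus the earlier \<open>c i\<close>, and \<open>0\<close>
  where all \<open>c n\<close> vanish; in the proof, \<open>A p\<close> is the part where it exceeds \<open>p\<close> and \<open>B q\<close> the part where
  it is below \<open>q\<close>.\<close>

lemma ex_C_c_coz_eq_SUP:
  fixes c :: "nat \<Rightarrow> 'a::frame"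
  assumes "\<And>n. complemented (c n)"
  shows "\<exists>\<alpha>\<in>C_c. coz \<alpha> = (SUP n. c n)"
proof -
  obtain w where w: "\<And>n. complement_of (SUP i\<in>{..<n}. c i) (w n)"
    using partial_join_complements[of c] assms by blast
  define x :: "nat \<Rightarrow> rat" where "x n = inverse (of_nat (Suc n))" for n
  have x_pos: "0 < x n" for n by (simp add: x_def)
  have x_anti: "x n \<le> x m" if "m \<le> n" for m n using that by (simp add: x_def)
  have x_null: "\<exists>n. x n < e" if "0 < e" for e
    using reals_Archimedean[of "real_of_rat e"] that
    by (metis (mono_tags, lifting) of_rat_inverse of_rat_less of_rat_of_nat_eq x_def zero_less_of_rat_iff)
  \<comment> \<open>The function is nonnegative, hence \<open>top\<close> for negative
    \<open>p\<close>. On all of \<open>c n\<close> its value is at least \<open>x n\<close>, so the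
    earlier terms need not be removed here.\<close>
  define A where "A p = (if p < 0 then top else SUP n\<in>{n. p < x n}. c n)" for p
  \<comment> \<open>On \<open>w k\<close> the first \<open>k\<close> terms vanish, so the value is
    at most \<open>x k\<close>.\<close>
  define B where "B q = (SUP k\<in>{k. x k < q}. w k)" for q
  have c_le_A: "c n \<le> A p" if "p < x n" for n p
    using that by (auto simp: A_def intro: SUP_upper)
  have w_le_B: "w k \<le> B q" if "x k < q" for k q
    using that by (auto simp: B_def intro: SUP_upper)
  have B_nonpos: "B q = bot" if "q \<le> 0" for q
  proof -
    have "{k. x k < q} = {}" using that x_pos by (auto simp: not_less intro: order_trans less_imp_le)
    then show ?thesis by (simp add: B_def)
  qed
  have Am: "A r \<le> A p" if "p \<le> r" for p r
  proof (cases "p < 0")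
    case False
    then show ?thesis using that by (auto simp: A_def intro!: SUP_subset_mono)
  qed (simp add: A_def)
  have Bm: "B p \<le> B r" if "p \<le> r" for p r
    using that by (auto simp: B_def intro!: SUP_subset_mono)
  \<comment> \<open>The source of all covering claims below: for the least \<open>k\<close> with
    \<open>P k\<close>, the terms before \<open>k\<close> together with \<open>w k\<close> join to
    \<open>top\<close>.\<close>
  have split: "z \<ge> top"
    if "\<exists>k. P k" "\<And>k. P k \<Longrightarrow> w k \<le> z" "\<And>n. \<not> P n \<Longrightarrow> c n \<le> z" for P and z :: 'a
  proof -
    from that(1) obtain k where k: "P k" "\<And>n. n < k \<Longrightarrow> \<not> P n" using exists_least_iff[of P] by blast
    have "top = sup (SUP i\<in>{..<k}. c i) (w k)" using w[of k] by (simp add: complement_of_def)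
    also have "\<dots> \<le> z" using that k by (intro sup_least SUP_least) auto
    finally show ?thesis .
  qed
  have A_top: "(SUP p. A p) = top"
    by (rule top_le, rule SUP_upper2[of "-1"]) (auto simp: A_def)
  have B_top: "(SUP q. B q) = top"
  proof -
    have "w 0 = top" using w[of 0] by (simp add: complement_of_def)
    moreover have "w 0 \<le> B 2" by (rule w_le_B) (simp add: x_def)
    ultimately have "top \<le> B 2" by simp
    then show ?thesis by (intro top_le SUP_upper2[of 2]) auto
  qed
  have R: "real_relations (\<lambda>p q. inf (A p) (B q))"
  proof (rule real_relations_scale[OF _ _ _ _ A_top B_top])
    fix p
    show "inf (A p) (B p) = bot"
    proof (cases "p < 0")
      case False
      \<comment> \<open>From \<open>x k < p < x n\<close> follows \<open>n < k\<close>, so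
        \<open>c n\<close> is among the terms complemented by \<open>w k\<close>.\<close>
      have "inf (c n) (w k) = bot" if "p < x n" "x k < p" for n k
      proof (rule complement_of_partial_join_disjoint[OF w])
        show "n < k" using x_anti[of k n] that by (metis less_trans not_le)
      qed
      with False show ?thesis
        by (auto simp: A_def B_def SUP_inf_frame inf_SUP_frame intro!: antisym SUP_least)
    qed (simp add: B_nonpos)
  next
    fix p q :: rat assume pq: "p < q"
    show "sup (A p) (B q) = top"
    proof (cases "p < 0")
      case False
      then have "\<exists>k. x k < q" using x_null pq by auto
      \<comment> \<open>Here \<open>P k\<close> is \<open>x k < q\<close>; where it fails,
        \<open>p < q \<le> x n\<close>.\<close>
      then have "sup (A p) (B q) \<ge> top"
        by (rule split) (use pq in \<open>auto intro!: le_supI1[OF c_le_A] le_supI2[OF w_le_B]\<close>)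
      then show ?thesis by (rule top_le)
    qed (simp add: A_def)
  next
    fix p
    show "A p = (SUP r\<in>{p<..}. A r)"
    proof (rule antisym)
      show "A p \<le> (SUP r\<in>{p<..}. A r)"
      proof (cases "p < 0")
        case True
        then obtain r where "p < r" "r < 0" using dense by blast
        then show ?thesis by (intro SUP_upper2[of r]) (auto simp: A_def)
      next
        case False
        have "c n \<le> (SUP r\<in>{p<..}. A r)" if n: "p < x n" for n
        proof -
          obtain r where "p < r" "r < x n" using dense n by blast
          then show ?thesis by (intro SUP_upper2[of r] c_le_A) auto
        qed
        with False show ?thesis by (subst A_def) (auto intro!: SUP_least)
      qed
    qed (auto intro!: SUP_least Am)
  next
    fix q
    show "B q = (SUP s\<in>{..<q}. B s)"
    proof (rule antisym)
      have "w k \<le> (SUP s\<in>{..<q}. B s)" if k: "x k < q" for k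
      proof -
        obtain s where "x k < s" "s < q" using dense k by blast
        then show ?thesis by (intro SUP_upper2[of s] w_le_B) auto
      qed
      then show "B q \<le> (SUP s\<in>{..<q}. B s)" by (subst B_def) (auto intro!: SUP_least)
    qed (auto intro!: SUP_least Bm)
  qed
  define \<alpha> where "\<alpha> = lift_gen (\<lambda>p q. inf (A p) (B q))"
  have hom: "frame_hom \<alpha>" unfolding \<alpha>_def by (rule frame_hom_lift_gen[OF R])
  note parts = parts_lift_gen_scale[OF R A_top B_top, folded \<alpha>_def]
  \<comment> \<open>Only the values 0 and \<open>x n\<close> of the function can belong to
    \<open>R_set \<alpha>\<close>. For positive \<open>t\<close>, \<open>split\<close> is applied
    with \<open>x k < t\<close>; as \<open>t\<close> is not a value, failure of this means
    \<open>t < x n\<close>.\<close>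
  have "t \<notin> R_set \<alpha>" if t: "t \<noteq> 0" "t \<notin> range (\<lambda>n. real_of_rat (x n))" for t
  proof -
    have "sup (SUP q\<in>{q. of_rat q < t}. B q) (SUP p\<in>{p. t < of_rat p}. A p) \<ge> top" (is "sup ?L ?U \<ge> top")
    proof (cases "t < 0")
      case True
      then obtain p where "t < of_rat p" "of_rat p < (0::real)" using of_rat_dense by blast
      then have "top \<le> ?U" by (intro SUP_upper2[of p]) (auto simp: A_def)
      then show ?thesis by (rule le_supI2)
    next
      case False
      with t have "0 < t" by simp
      then obtain e where e: "0 < real_of_rat e" "of_rat e < t" using of_rat_dense by blast
      then obtain k where "x k < e" using x_null by auto
      then have "real_of_rat (x k) < of_rat e" by (simp add: of_rat_less)
      with e have "real_of_rat (x k) < t" by linarith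
      then have ex: "\<exists>k. of_rat (x k) < t" by blast
      have "w k \<le> ?L" if "of_rat (x k) < t" for k
      proof -
        obtain q where q: "of_rat (x k) < real_of_rat q" "of_rat q < t" using of_rat_dense \<open>of_rat (x k) < t\<close> by blast
        then show ?thesis by (intro SUP_upper2[of q] w_le_B) (auto simp: of_rat_less)
      qed
      moreover have "c n \<le> ?U" if "\<not> of_rat (x n) < t" for n
      proof -
        have "t \<noteq> of_rat (x n)" using t(2) by blast
        with that have "t < of_rat (x n)" by simp
        then obtain p where q: "t < of_rat p" "of_rat p < real_of_rat (x n)" using of_rat_dense by blast
        then show ?thesis by (intro SUP_upper2[of p] c_le_A) (auto simp: of_rat_less)
      qed
      ultimately show ?thesis using split[OF ex, of "sup ?L ?U"] le_supI1 le_supI2 by blast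
    qed
    then show ?thesis by (simp add: notin_R_set_iff[OF hom] parts top_le)
  qed
  then have "R_set \<alpha> \<subseteq> insert 0 (range (\<lambda>n. real_of_rat (x n)))" by blast
  then have "countable (R_set \<alpha>)" by (rule countable_subset) simp
  with hom have "\<alpha> \<in> C_c" by (simp add: C_c_def RL_def)
  moreover have "coz \<alpha> = (SUP n. c n)"
  proof -
    have "(SUP q\<in>{q. real_of_rat q < 0}. B q) = bot"
      using B_nonpos by (auto intro!: antisym SUP_least)
    moreover have "(SUP p\<in>{p. 0 < real_of_rat p}. A p) = (SUP n. c n)"
    proof (rule antisym)
      show "(SUP p\<in>{p. 0 < real_of_rat p}. A p) \<le> (SUP n. c n)"
        by (auto simp: A_def intro!: SUP_least SUP_upper)
      have "c n \<le> (SUP p\<in>{p. 0 < real_of_rat p}. A p)" for n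
      proof -
        obtain p where "0 < p" "p < x n" using dense[OF x_pos] by blast
        then show ?thesis by (intro SUP_upper2[of p] c_le_A) auto
      qed
      then show "(SUP n. c n) \<le> (SUP p\<in>{p. 0 < real_of_rat p}. A p)" by (intro SUP_least)
    qed
    ultimately show ?thesis by (simp add: coz_conv_parts[OF hom] parts)
  qed
  ultimately show ?thesis by blast
qed

lemma coz_image_C_c: "coz ` C_c = (sigma_complemented :: 'a::frame set)"
proof
  show "coz ` C_c \<subseteq> (sigma_complemented :: 'a set)" using coz_C_c_sigma_complemented by blast
  show "(sigma_complemented :: 'a set) \<subseteq> coz ` C_c"
  proof
    fix a :: 'a assume "a \<in> sigma_complemented"
    then obtain c :: "nat \<Rightarrow> 'a" where "\<And>n. complemented (c n)" "a = (SUP n. c n)"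
      by (rule sigma_complemented_sequence) (rule that)
    then show "a \<in> coz ` C_c" using ex_C_c_coz_eq_SUP[of c] by (metis imageI)
  qed
qed

subsection \<open>The \<open>\<sigma>\<close>-frame of cozero elements\<close>

context
  fixes Z :: "'a::complete_lattice set" and M :: "'a gorder"
  defines "M \<equiv> \<lparr>carrier = Z, eq = (=), le = (\<le>)\<rparr>"
begin

lemma subset_order_partial_order: "partial_order M"
  by unfold_locales (auto simp: M_def)

text \<open>The upper bounds of \<open>A\<close> within \<open>Z\<close> are the members of
  \<open>Z\<close> above \<open>Sup A\<close>. Once \<open>Sup A\<close> lies in \<open>Z\<close>,
  it is the least of them; otherwise a join in \<open>Z\<close> could differ from the ambient
  one.\<close>

lemma subset_order_least_iff:
  assumes "A \<subseteq> Z" "Sup A \<in> Z"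
  shows "least M x (Upper M A) \<longleftrightarrow> x = Sup A"
proof -
  have "Upper M A = {u \<in> Z. Sup A \<le> u}" using assms(1) by (auto simp: M_def Upper_def Sup_le_iff)
  then show ?thesis using assms(2) by (auto simp: M_def least_def intro: antisym)
qed

lemma subset_order_greatest_iff:
  assumes "A \<subseteq> Z" "Inf A \<in> Z"
  shows "greatest M x (Lower M A) \<longleftrightarrow> x = Inf A"
proof -
  have "Lower M A = {l \<in> Z. l \<le> Inf A}" using assms(1) by (auto simp: M_def Lower_def le_Inf_iff)
  then show ?thesis using assms(2) by (auto simp: M_def greatest_def intro: antisym)
qed

lemma subset_order_Sup: "A \<subseteq> Z \<Longrightarrow> Sup A \<in> Z \<Longrightarrow> \<Squnion>\<^bsub>M\<^esub>A = Sup A"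
  by (simp add: Lattice.sup_def subset_order_least_iff)

lemma subset_order_join: "a \<in> Z \<Longrightarrow> b \<in> Z \<Longrightarrow> sup a b \<in> Z \<Longrightarrow> a \<squnion>\<^bsub>M\<^esub> b = sup a b"
  by (simp add: join_def subset_order_Sup)

lemma subset_order_meet: "a \<in> Z \<Longrightarrow> b \<in> Z \<Longrightarrow> inf a b \<in> Z \<Longrightarrow> a \<sqinter>\<^bsub>M\<^esub> b = inf a b"
  by (simp add: meet_def Lattice.inf_def subset_order_greatest_iff)

lemma subset_order_least_carrier: "bot \<in> Z \<Longrightarrow> least M x Z \<longleftrightarrow> x = bot"
  by (auto simp: M_def least_def bot_unique)

lemma subset_order_greatest_carrier: "top \<in> Z \<Longrightarrow> greatest M x Z \<longleftrightarrow> x = top"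
  by (auto simp: M_def greatest_def top_unique)

lemma subset_order_bottom: "bot \<in> Z \<Longrightarrow> \<bottom>\<^bsub>M\<^esub> = bot"
  using subset_order_least_carrier by (simp add: bottom_def M_def)

lemma subset_order_top: "top \<in> Z \<Longrightarrow> \<top>\<^bsub>M\<^esub> = top"
  using subset_order_greatest_carrier by (simp add: Order.top_def M_def)

end

section \<open>Operations of \<open>Coz_c\<close> as operations of the frame\<close>

lemma Coz_c_eq: "Coz_c TYPE('a::frame) = \<lparr>carrier = sigma_complemented, eq = (=), le = (\<le>)\<rparr>"
  by (simp add: Coz_c_def coz_image_C_c)

lemma carrier_Coz_c: "carrier (Coz_c TYPE('a::frame)) = sigma_complemented"
  and le_Coz_c: "(\<sqsubseteq>\<^bsub>Coz_c TYPE('a)\<^esub>) = (\<le>)"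
  by (simp_all add: Coz_c_eq)

lemma sigma_complemented_bot: "bot \<in> sigma_complemented"
  and sigma_complemented_top: "top \<in> sigma_complemented"
  by (intro complemented_imp_sigma complemented_bot complemented_top)+

lemma Coz_c_Sup:
  "countable S \<Longrightarrow> S \<subseteq> sigma_complemented \<Longrightarrow> \<Squnion>\<^bsub>Coz_c TYPE('a::frame)\<^esub>S = Sup S"
  by (simp add: Coz_c_eq subset_order_Sup sigma_complemented_Sup)

lemma Coz_c_join:
  "a \<in> sigma_complemented \<Longrightarrow> b \<in> sigma_complemented \<Longrightarrow> a \<squnion>\<^bsub>Coz_c TYPE('a::frame)\<^esub> b = sup a b"
  by (simp add: Coz_c_eq subset_order_join sigma_complemented_sup)

lemma Coz_c_meet:
  "a \<in> sigma_complemented \<Longrightarrow> b \<in> sigma_complemented \<Longrightarrow> a \<sqinter>\<^bsub>Coz_c TYPE('a::frame)\<^esub> b = inf a b"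
  by (simp add: Coz_c_eq subset_order_meet sigma_complemented_inf)

lemma Coz_c_bottom: "\<bottom>\<^bsub>Coz_c TYPE('a::frame)\<^esub> = bot"
  and Coz_c_top: "\<top>\<^bsub>Coz_c TYPE('a)\<^esub> = top"
  by (simp_all add: Coz_c_eq subset_order_bottom subset_order_top
      sigma_complemented_bot sigma_complemented_top)

lemma cover_Coz_c_iff:
  "cover (Coz_c TYPE('a::frame)) a \<longleftrightarrow> range a \<subseteq> sigma_complemented \<and> (SUP n. a n) = top"
  by (auto simp: cover_def carrier_Coz_c Coz_c_Sup Coz_c_top)

text \<open>Binary meets and countable joins agree with those of the ambient frame, by closure of
  \<open>sigma_complemented\<close>, so the laws are inherited.\<close>

lemma sigma_frame_Coz_c: "sigma_frame (Coz_c TYPE('a::frame))"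
proof -
  let ?M = "Coz_c TYPE('a)"
  interpret partial_order ?M
    unfolding Coz_c_eq by (rule subset_order_partial_order)
  have lub: "is_lub ?M (Sup S) S" if "countable S" "S \<subseteq> sigma_complemented" for S
    using that by (simp add: Coz_c_eq subset_order_least_iff sigma_complemented_Sup)
  show ?thesis
  proof
    fix x y assume xy: "x \<in> carrier ?M" "y \<in> carrier ?M"
    show "\<exists>s. is_lub ?M s {x, y}"
      using lub[of "{x, y}"] xy by (auto simp: carrier_Coz_c)
    have "is_glb ?M (Inf {x, y}) {x, y}"
      unfolding Coz_c_eq
      by (subst subset_order_greatest_iff) (use xy in \<open>auto simp: carrier_Coz_c sigma_complemented_inf\<close>)
    then show "\<exists>s. is_glb ?M s {x, y}" by blast
  next
    show "\<exists>x. least ?M x (carrier ?M)" "\<exists>x. greatest ?M x (carrier ?M)"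
      unfolding carrier_Coz_c
      by (simp_all add: Coz_c_eq subset_order_least_carrier subset_order_greatest_carrier
          sigma_complemented_bot sigma_complemented_top)
  next
    fix x y z assume "x \<in> carrier ?M" "y \<in> carrier ?M" "z \<in> carrier ?M"
    then show "x \<sqinter>\<^bsub>?M\<^esub> (y \<squnion>\<^bsub>?M\<^esub> z) = (x \<sqinter>\<^bsub>?M\<^esub> y) \<squnion>\<^bsub>?M\<^esub> (x \<sqinter>\<^bsub>?M\<^esub> z)"
      by (simp add: carrier_Coz_c Coz_c_join Coz_c_meet sigma_complemented_sup
          sigma_complemented_inf inf_sup_distrib1)
  next
    fix S assume "S \<subseteq> carrier ?M" "countable S"
    then show "\<exists>s. is_lub ?M s S" using lub by (auto simp: carrier_Coz_c)
  next
    fix a S assume A: "a \<in> carrier ?M" "S \<subseteq> carrier ?M" "countable S"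
    then have im: "(\<lambda>s. a \<sqinter>\<^bsub>?M\<^esub> s) ` S = inf a ` S"
      by (intro image_cong) (auto simp: carrier_Coz_c Coz_c_meet)
    have "inf a ` S \<subseteq> sigma_complemented"
      using A by (auto simp: carrier_Coz_c sigma_complemented_inf)
    then show "a \<sqinter>\<^bsub>?M\<^esub> \<Squnion>\<^bsub>?M\<^esub>S = \<Squnion>\<^bsub>?M\<^esub>((\<lambda>s. a \<sqinter>\<^bsub>?M\<^esub> s) ` S)"
      unfolding im using A
      by (simp add: carrier_Coz_c Coz_c_Sup Coz_c_meet sigma_complemented_Sup inf_Sup_frame)
  qed
qed

section \<open>Covers: refinement, paracompactness and shrinking\<close>

lemma disjoint_refinement_of_cover:
  assumes "cover (Coz_c TYPE('a::frame)) a"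
  obtains d :: "nat \<Rightarrow> 'a::frame" and f where "\<And>j. complemented (d j)" "(SUP j. d j) = top"
    "\<And>i j. i \<noteq> j \<Longrightarrow> inf (d i) (d j) = bot" "\<And>j. d j \<le> a (f j)"
proof -
  have a: "a n \<in> sigma_complemented" "(SUP n. a n) = top" for n
    using assms by (auto simp: cover_Coz_c_iff)
  have "\<forall>n. \<exists>c :: nat \<Rightarrow> 'a. (\<forall>k. complemented (c k)) \<and> a n = (SUP k. c k)"
    using a(1) sigma_complemented_sequence by metis
  then obtain c :: "nat \<Rightarrow> nat \<Rightarrow> 'a" where c: "\<And>n k. complemented (c n k)" "\<And>n. a n = (SUP k. c n k)"
    by metis
  \<comment> \<open>The double family becomes one sequence of complemented elements, which can be
    made disjoint; the first coordinate of the decoded index remembers which \<open>a n\<close> a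
    term came from.\<close>
  define e where "e j = (case prod_decode j of (n, k) \<Rightarrow> c n k)" for j
  have "complemented (e j)" for j by (simp add: e_def c(1) split: prod.split)
  then obtain d where d: "\<And>j. complemented (d j)" "\<And>j. d j \<le> e j" "(SUP j. d j) = (SUP j. e j)"
    "\<And>i j. i \<noteq> j \<Longrightarrow> inf (d i) (d j) = bot"
    using disjoint_complemented_refinement[of e] by metis
  have "a n \<le> (SUP j. e j)" for n
    unfolding c(2)
  proof (rule SUP_least)
    fix k show "c n k \<le> (SUP j. e j)"
      by (rule SUP_upper2[of "prod_encode (n, k)"]) (simp_all add: e_def)
  qed
  then have "(SUP n. a n) \<le> (SUP j. e j)" by (rule SUP_least)
  then have "(SUP j. d j) = top" using a(2) d(3) by (simp add: top_le)
  moreover have "e j \<le> a (fst (prod_decode j))" for j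
    by (auto simp: e_def c(2) split: prod.split intro: SUP_upper)
  then have "d j \<le> a (fst (prod_decode j))" for j using d(2) order_trans by blast
  ultimately show thesis using that[of d "\<lambda>j. fst (prod_decode j)"] d(1,4) by blast
qed

lemma paracompact_Coz_c: "paracompact (Coz_c TYPE('a::frame))"
  unfolding paracompact_def
proof (intro allI impI)
  fix a assume "cover (Coz_c TYPE('a)) a"
  then obtain d :: "nat \<Rightarrow> 'a" and f where d: "\<And>j. complemented (d j)" "(SUP j. d j) = top"
    "\<And>i j. i \<noteq> j \<Longrightarrow> inf (d i) (d j) = bot" "\<And>j. d j \<le> a (f j)"
    by (rule disjoint_refinement_of_cover) (rule that)
  have "cover (Coz_c TYPE('a)) d" using d by (auto simp: cover_Coz_c_iff complemented_imp_sigma)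
  moreover have "n \<notin> {m} \<Longrightarrow> d m \<sqinter>\<^bsub>Coz_c TYPE('a)\<^esub> d n = \<bottom>\<^bsub>Coz_c TYPE('a)\<^esub>" for m n
    using d(1,3) by (simp add: Coz_c_meet Coz_c_bottom complemented_imp_sigma)
  ultimately have "locally_finite_cover (Coz_c TYPE('a)) d"
    unfolding locally_finite_cover_def
    by (intro conjI exI[of _ d] exI[of _ "\<lambda>m. {m}"] allI impI) auto
  with d(4) show "\<exists>b. locally_finite_cover (Coz_c TYPE('a)) b \<and> (\<forall>m. \<exists>n. b m \<sqsubseteq>\<^bsub>Coz_c TYPE('a)\<^esub> a n)"
    by (auto simp: le_Coz_c)
qed

text \<open>Joins of disjoint pieces over index sets turn disjoint sets into disjoint elements and
  unions into joins. As all pieces together give \<open>top\<close>, complementary index sets give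
  complements.\<close>

lemma shrinkable_Coz_c:
  assumes "cover (Coz_c TYPE('a::frame)) a"
  shows "shrinkable (Coz_c TYPE('a)) a"
proof -
  obtain d :: "nat \<Rightarrow> 'a" and f where d: "\<And>j. complemented (d j)" "(SUP j. d j) = top"
    "\<And>i j. i \<noteq> j \<Longrightarrow> inf (d i) (d j) = bot" "\<And>j. d j \<le> a (f j)"
    using assms by (rule disjoint_refinement_of_cover) (rule that)
  have a: "a n \<in> sigma_complemented" for n using assms by (auto simp: cover_Coz_c_iff)
  define u where "u J = (SUP j\<in>J. d j)" for J
  have u: "u J \<in> sigma_complemented" for J
    unfolding u_def by (rule sigma_complementedI) (auto simp: d)
  have disj: "inf (u I) (u J) = bot" if "I \<inter> J = {}" for I J
    unfolding u_def SUP_inf_frame inf_SUP_frame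
    using d(3) that by (intro antisym SUP_least bot_least) (metis disjoint_iff order_refl)
  have un: "sup (u I) (u J) = u (I \<union> J)" for I J
    by (simp add: u_def SUP_union)
  \<comment> \<open>Grouping the pieces by \<open>f\<close> restores the indexing by
    \<open>n\<close>; an index outside the range of \<open>f\<close> receives the empty join
    \<open>bot\<close>.\<close>
  let ?e = "\<lambda>n. u (f -` {n})"
  have "d j \<le> (SUP n. ?e n)" for j
    by (rule SUP_upper2[of "f j"]) (auto simp: u_def intro: SUP_upper)
  then have "(SUP j. d j) \<le> (SUP n. ?e n)" by (rule SUP_least)
  then have "cover (Coz_c TYPE('a)) ?e"
    using u d(2) by (auto simp: cover_Coz_c_iff top_le)
  moreover have "rather_below (Coz_c TYPE('a)) (?e n) (a n)" for n
    unfolding rather_below_def carrier_Coz_c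
  proof (intro bexI conjI)
    \<comment> \<open>The pieces not assigned to \<open>n\<close> form the complement of
      \<open>?e n\<close>; since \<open>?e n \<le> a n\<close>, this complement also joins with
      \<open>a n\<close> to \<open>top\<close>.\<close>
    let ?x = "u (- (f -` {n}))"
    show "?x \<in> sigma_complemented" by (rule u)
    show "?e n \<sqinter>\<^bsub>Coz_c TYPE('a)\<^esub> ?x = \<bottom>\<^bsub>Coz_c TYPE('a)\<^esub>"
      by (simp add: Coz_c_meet Coz_c_bottom u disj)
    have "?e n \<le> a n" using d(4) by (auto simp: u_def intro!: SUP_least)
    then have "sup ?x (?e n) \<le> sup ?x (a n)" by (rule sup_mono[OF order_refl])
    moreover have "sup ?x (?e n) = top" using d(2) by (simp add: un) (simp add: u_def)
    ultimately show "?x \<squnion>\<^bsub>Coz_c TYPE('a)\<^esub> a n = \<top>\<^bsub>Coz_c TYPE('a)\<^esub>"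
      by (simp add: Coz_c_join Coz_c_top u a top_le)
  qed
  ultimately show ?thesis unfolding shrinkable_def by blast
qed

theorem proposition6p9:
  assumes "completely_regular TYPE('a::frame)"
  shows "sigma_frame (Coz_c TYPE('a)) \<and>
         paracompact (Coz_c TYPE('a)) \<and>
         (\<forall>a. cover (Coz_c TYPE('a)) a \<longrightarrow> shrinkable (Coz_c TYPE('a)) a)"
  using sigma_frame_Coz_c paracompact_Coz_c shrinkable_Coz_c by blast

end
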